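(* Let $\alpha>-1$, let $n\in\mathbb{N}$, and let $\mu,\eta\in\mathbb{C}$ with $|\mu|=|\eta|=1$. Let $\phi:\mathbb{D}\to\mathbb{D}$ be analytic and let $\psi$ be an analytic function on $\mathbb{D}$, not identically zero, such that the operator $D_{n,\psi,\phi}$ is bounded on $\mathcal{A}^2_\alpha$. Then $D_{n,\psi,\phi}$ is complex symmetric on $\mathcal{A}^2_\alpha$ with conjugation $C_{\mu,\eta}$ if and only if there exist $a,c\in\mathbb{C}$ and $b\in\mathbb{D}$ such that $$\psi(z)=\frac{az^n}{(1-\eta bz)^{n+\alpha+2}}\quad\text{and}\quad \phi(z)=b+\frac{cz}{1-\eta bz}\quad\text{for all } z\in\mathbb{D}.$$
   Context: $\mathbb{D}=\{z\in\mathbb{C}:|z|<1\}$ and $\mathbb{N}=\{1,2,3,\dots\}$. For $-1<\alpha<\infty$, the weighted Bergman space $\mathcal{A}^2_\alpha$ is the Hilbert space of analytic functions $f$ on $\mathbb{D}$ with $\|f\|^2=\int_{\mathbb{D}}|f(z)|^2(\alpha+1)(1-|z|^2)^\alpha\,dA(z)<\infty$, where $dA$ is the normalized area measure on $\mathbb{D}$ (total mass 1). The weighted composition-differentiation operator is $(D_{n,\psi,\phi}f)(z)=\psi(z)f^{(n)}(\phi(z))$, where $f^{(n)}$ is the $n$-th derivative. "Bounded on $\mathcal{A}^2_\alpha$" means that it defines a bounded linear operator from $\mathcal{A}^2_\alpha$ to itself. A conjugation on a Hilbert space $\mathcal{H}$ is an antilinear map $\mathcal{C}:\mathcal{H}\to\mathcal{H}$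 with $\langle \mathcal{C}x,\mathcal{C}y\rangle=\langle y,x\rangle$ for all $x,y$ and $\mathcal{C}^2=I$. A bounded operator $T$ is complex symmetric with conjugation $\mathcal{C}$ if $T=\mathcal{C}T^*\mathcal{C}$. The conjugation $C_{\mu,\eta}$ is $(C_{\mu,\eta}f)(z)=\mu\,\overline{f(\overline{\eta z})}$. Non-integer powers $(1-\zeta)^s$ with $|\zeta|<1$ use the principal branch. *)

theory Defs
  imports "HOL-Complex_Analysis.Complex_Analysis"
begin

text \<open>
  Hilbert spaces of functions are given by a carrier \<open>H\<close>, closed under pointwise linear
  combinations, and an inner product \<open>ip\<close>, linear in its first argument.
\<close>

definition ip_norm :: "(('a \<Rightarrow> complex) \<Rightarrow> ('a \<Rightarrow> complex) \<Rightarrow> complex) \<Rightarrow> ('a \<Rightarrow> complex) \<Rightarrow> real"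
  where "ip_norm ip f = sqrt (Re (ip f f))"

definition bounded_operator_on ::
  "('a \<Rightarrow> complex) set \<Rightarrow> (('a \<Rightarrow> complex) \<Rightarrow> ('a \<Rightarrow> complex) \<Rightarrow> complex)
    \<Rightarrow> (('a \<Rightarrow> complex) \<Rightarrow> ('a \<Rightarrow> complex)) \<Rightarrow> bool"
  where "bounded_operator_on H ip T \<longleftrightarrow>
    (\<forall>f\<in>H. T f \<in> H) \<and>
    (\<forall>f\<in>H. \<forall>g\<in>H. \<forall>a b. T (\<lambda>z. a * f z + b * g z) = (\<lambda>z. a * T f z + b * T g z)) \<and>
    (\<exists>M. \<forall>f\<in>H. ip_norm ip (T f) \<le> M * ip_norm ip f)"

text \<open>
  For a bounded \<open>T\<close> on a complete \<open>H\<close> the described vector exists by Riesz representation and is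
  unique when \<open>ip\<close> is definite; in general the description may be improper.
\<close>

definition adjoint_on ::
  "('a \<Rightarrow> complex) set \<Rightarrow> (('a \<Rightarrow> complex) \<Rightarrow> ('a \<Rightarrow> complex) \<Rightarrow> complex)
    \<Rightarrow> (('a \<Rightarrow> complex) \<Rightarrow> ('a \<Rightarrow> complex)) \<Rightarrow> ('a \<Rightarrow> complex) \<Rightarrow> ('a \<Rightarrow> complex)"
  where "adjoint_on H ip T g = (THE h. h \<in> H \<and> (\<forall>f\<in>H. ip (T f) g = ip f h))"

definition conjugation_on ::
  "('a \<Rightarrow> complex) set \<Rightarrow> (('a \<Rightarrow> complex) \<Rightarrow> ('a \<Rightarrow> complex) \<Rightarrow> complex)
    \<Rightarrow> (('a \<Rightarrow> complex) \<Rightarrow> ('a \<Rightarrow> complex)) \<Rightarrow> bool"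
  where "conjugation_on H ip C \<longleftrightarrow>
    (\<forall>f\<in>H. C f \<in> H) \<and>
    (\<forall>f\<in>H. \<forall>g\<in>H. \<forall>a b. C (\<lambda>z. a * f z + b * g z) = (\<lambda>z. cnj a * C f z + cnj b * C g z)) \<and>
    (\<forall>f\<in>H. \<forall>g\<in>H. ip (C f) (C g) = ip g f) \<and>
    (\<forall>f\<in>H. C (C f) = f)"

definition complex_symmetric_on ::
  "('a \<Rightarrow> complex) set \<Rightarrow> (('a \<Rightarrow> complex) \<Rightarrow> ('a \<Rightarrow> complex) \<Rightarrow> complex)
    \<Rightarrow> (('a \<Rightarrow> complex) \<Rightarrow> ('a \<Rightarrow> complex)) \<Rightarrow> (('a \<Rightarrow> complex) \<Rightarrow> ('a \<Rightarrow> complex)) \<Rightarrow> bool"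
  where "complex_symmetric_on H ip C T \<longleftrightarrow>
    bounded_operator_on H ip T \<and> conjugation_on H ip C \<and>
    (\<forall>f\<in>H. T f = C (adjoint_on H ip T (C f)))"

abbreviation unit_disc :: "complex set"
  where "unit_disc \<equiv> ball 0 1"

text \<open>The factor \<open>1 / pi\<close> normalizes the area measure of the disc to total mass 1.\<close>

definition bergman_measure :: "real \<Rightarrow> complex measure"
  where "bergman_measure \<alpha> =
    density (restrict_space lborel unit_disc)
      (\<lambda>z. ennreal ((\<alpha> + 1) * (1 - (cmod z)\<^sup>2) powr \<alpha> / pi))"

text \<open>
  An analytic function on the disc is represented by its extension by 0 to the whole plane,
  so that equality of elements of the space is equality of functions on the disc.
\<close>

definition bergman_space :: "real \<Rightarrow> (complex \<Rightarrow> complex) set"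
  where "bergman_space \<alpha> =
    {f. f holomorphic_on unit_disc \<and> (\<forall>z. z \<notin> unit_disc \<longrightarrow> f z = 0) \<and>
        integrable (bergman_measure \<alpha>) (\<lambda>z. (cmod (f z))\<^sup>2)}"

definition bergman_ip :: "real \<Rightarrow> (complex \<Rightarrow> complex) \<Rightarrow> (complex \<Rightarrow> complex) \<Rightarrow> complex"
  where "bergman_ip \<alpha> f g = (LINT z|bergman_measure \<alpha>. f z * cnj (g z))"

definition wcomp_diff ::
  "nat \<Rightarrow> (complex \<Rightarrow> complex) \<Rightarrow> (complex \<Rightarrow> complex) \<Rightarrow> (complex \<Rightarrow> complex) \<Rightarrow> (complex \<Rightarrow> complex)"
  where "wcomp_diff n \<psi> \<phi> f =
    (\<lambda>z. if z \<in> unit_disc then \<psi> z * (deriv ^^ n) f (\<phi> z) else 0)"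

text \<open>
  For \<open>cmod \<eta> = 1\<close> the map \<open>z \<mapsto> cnj (\<eta> * z)\<close> preserves the disc and its complement, so
  functions vanishing outside the disc are mapped to such functions.
\<close>

definition conj_op :: "complex \<Rightarrow> complex \<Rightarrow> (complex \<Rightarrow> complex) \<Rightarrow> (complex \<Rightarrow> complex)"
  where "conj_op \<mu> \<eta> f = (\<lambda>z. \<mu> * cnj (f (cnj (\<eta> * z))))"

end

theory Submission
  imports Defs
begin

text \<open>
  The proof evaluates the symmetry condition on reproducing kernels.  Write \<open>D\<close> for the operator,
  \<open>C\<close> for the conjugation and \<open>K w\<close> for the reproducing kernel at \<open>w\<close>, the vector with
  \<open>f w = \<langle>f, K w\<rangle>\<close>.  Since \<open>C\<close> is an involution, complex symmetry means that \<open>D C\<close> equals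
  \<open>C\<close> composed with the adjoint of \<open>D\<close>.  The adjoint is explicit on kernels: it maps \<open>K w\<close> to
  \<open>cnj (\<psi> w)\<close> times the vector that represents the functional taking \<open>f\<close> to its \<open>n\<close>-th derivative
  at \<open>\<phi> w\<close>.  That vector is \<open>z ^ n * (1 - cnj (\<phi> w) * z) powr - (n + \<alpha> + 2)\<close> up to a constant
  (\<open>bergman_ip_kernel\<close>).  So on kernels complex symmetry becomes the functional equation
  \<open>\<psi> z * w ^ n * (1 - \<eta> * w * \<phi> z) powr - s = \<psi> w * z ^ n * (1 - \<eta> * z * \<phi> w) powr - s\<close>
  on the disc, where \<open>s = n + \<alpha> + 2\<close>
  (\<open>complex_symmetric_iff_functional_equation\<close>).  Conversely, the functional equation gives
  symmetry on kernels, and boundedness of the operator extends it to the whole space, because a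
  bounded functional that vanishes on all kernels is zero (\<open>bergman_kernels_total\<close>).

  The functional equation is elementary.  Letting \<open>w \<rightarrow> 0\<close> determines \<open>\<psi>\<close>, and differentiating in \<open>z\<close>
  at \<open>0\<close> then determines \<open>\<phi>\<close> (\<open>explicit_if_functional_equation\<close>).  For \<open>\<psi>\<close> and \<open>\<phi>\<close> of the stated
  form both sides equal the same expression, symmetric in \<open>z\<close> and \<open>w\<close>
  (\<open>functional_equation_if_explicit\<close>).

  The facts about the Bergman space that this uses come from its monomials.  They are orthogonal
  because the measure is invariant under rotations, their norms are Beta integrals, and Parseval's
  identity on discs of radius \<open>r < 1\<close>, where Taylor series converge uniformly, passes to the limit
  \<open>r = 1\<close>.  Hence the Taylor polynomials of an element converge to it in norm
  (\<open>taylor_poly_tendsto\<close>).  The binomial series relates the kernels to the monomials.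
\<close>

section \<open>Rotation invariance of planar area\<close>

lemma lborel_complex_eq_distr: "distr (lborel \<Otimes>\<^sub>M lborel) borel (\<lambda>(x, y). Complex x y) = lborel"
proof (rule lborel_eqI[symmetric])
  have [measurable]: "(\<lambda>(x, y). Complex x y) \<in> borel_measurable (lborel \<Otimes>\<^sub>M lborel)"
    unfolding Complex_eq by measurable
  fix l u :: complex
  assume le: "\<And>b. b \<in> Basis \<Longrightarrow> l \<bullet> b \<le> u \<bullet> b"
  from le[of 1] le[of \<i>] have "Re l \<le> Re u" "Im l \<le> Im u"
    by (auto simp: Basis_complex_def inner_complex_def)
  moreover have "(\<lambda>(x, y). Complex x y) -` box l u \<inter> space (lborel \<Otimes>\<^sub>M lborel)
      = box (Re l) (Re u) \<times> box (Im l) (Im u)"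
    by (auto simp: box_def Basis_complex_def inner_complex_def space_pair_measure)
  ultimately show "emeasure (distr (lborel \<Otimes>\<^sub>M lborel) borel (\<lambda>(x, y). Complex x y)) (box l u)
      = (\<Prod>b\<in>Basis. (u - l) \<bullet> b)"
    by (simp add: emeasure_distr lborel.emeasure_pair_measure_Times Basis_complex_def
        inner_complex_def ennreal_mult)
qed simp

lemma nn_integral_lborel_complex:
  fixes f :: "complex \<Rightarrow> ennreal"
  assumes [measurable]: "f \<in> borel_measurable borel"
  shows "(\<integral>\<^sup>+z. f z \<partial>lborel) = (\<integral>\<^sup>+x. \<integral>\<^sup>+y. f (Complex x y) \<partial>lborel \<partial>lborel)"
    and "(\<integral>\<^sup>+z. f z \<partial>lborel) = (\<integral>\<^sup>+y. \<integral>\<^sup>+x. f (Complex x y) \<partial>lborel \<partial>lborel)"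
proof -
  have [measurable]: "(\<lambda>p. Complex (fst p) (snd p)) \<in> borel_measurable (lborel \<Otimes>\<^sub>M lborel)"
    unfolding Complex_eq by measurable
  have eq: "(\<integral>\<^sup>+z. f z \<partial>lborel) = (\<integral>\<^sup>+p. f (Complex (fst p) (snd p)) \<partial>(lborel \<Otimes>\<^sub>M lborel))"
    by (subst lborel_complex_eq_distr[symmetric]) (simp add: nn_integral_distr case_prod_unfold)
  then show "(\<integral>\<^sup>+z. f z \<partial>lborel) = (\<integral>\<^sup>+x. \<integral>\<^sup>+y. f (Complex x y) \<partial>lborel \<partial>lborel)"
    by (subst (asm) lborel.nn_integral_fst[symmetric]) simp_all
  with lborel_pair.Fubini'[of "\<lambda>x y. f (Complex x y)"]
  show "(\<integral>\<^sup>+z. f z \<partial>lborel) = (\<integral>\<^sup>+y. \<integral>\<^sup>+x. f (Complex x y) \<partial>lborel \<partial>lborel)"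
    by (simp add: case_prod_unfold)
qed

definition preserves_area :: "(complex \<Rightarrow> complex) \<Rightarrow> bool" where
  "preserves_area R \<longleftrightarrow> R \<in> borel_measurable borel \<and> distr lborel borel R = lborel"

lemma preserves_area_comp:
  assumes "preserves_area R" "preserves_area S"
  shows "preserves_area (\<lambda>z. R (S z))"
proof -
  from assms have [measurable]: "R \<in> borel_measurable borel" "S \<in> borel_measurable borel"
    by (auto simp: preserves_area_def)
  have "distr lborel borel (\<lambda>z. R (S z)) = distr (distr lborel borel S) borel R"
    by (subst distr_distr) (auto simp: comp_def)
  then show ?thesis
    using assms by (auto simp: preserves_area_def)
qed

lemma preserves_areaI:
  assumes [measurable]: "R \<in> borel_measurable borel"
    and eq: "\<And>f :: complex \<Rightarrow> ennreal. f \<in> borel_measurable borel \<Longrightarrow>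
      (\<integral>\<^sup>+z. f (R z) \<partial>lborel) = (\<integral>\<^sup>+z. f z \<partial>lborel)"
  shows "preserves_area R"
  unfolding preserves_area_def
proof (intro conjI measure_eqI)
  fix A assume "A \<in> sets (distr lborel borel R)"
  then have [measurable]: "A \<in> sets borel" by simp
  have "emeasure (distr lborel borel R) A = (\<integral>\<^sup>+z. indicator A (R z) \<partial>lborel)"
    using nn_integral_distr[of R lborel borel "indicator A"] by simp
  also have "\<dots> = emeasure lborel A"
    by (subst eq) auto
  finally show "emeasure (distr lborel borel R) A = emeasure lborel A" .
qed auto

text \<open>
  Orthogonal maps of the plane are built from shears: a shear moves every horizontal (or vertical)
  line by a translation within itself, so it preserves area by Fubini's theorem, and every rotation
  except the half-turn is a product of three shears.
\<close>

lemma preserves_area_shear_Re: "preserves_area (\<lambda>z. Complex (Re z + t * Im z) (Im z))"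
proof (rule preserves_areaI)
  show [measurable]: "(\<lambda>z. Complex (Re z + t * Im z) (Im z)) \<in> borel_measurable borel"
    unfolding Complex_eq by measurable
  fix f :: "complex \<Rightarrow> ennreal" assume [measurable]: "f \<in> borel_measurable borel"
  have [measurable]: "(\<lambda>x. Complex x y) \<in> borel_measurable borel" for y
    unfolding Complex_eq by measurable
  have "(\<integral>\<^sup>+z. f (Complex (Re z + t * Im z) (Im z)) \<partial>lborel)
      = (\<integral>\<^sup>+y. \<integral>\<^sup>+x. f (Complex (t * y + x) y) \<partial>lborel \<partial>lborel)"
    by (subst nn_integral_lborel_complex(2)) (auto simp: add.commute)
  also have "\<dots> = (\<integral>\<^sup>+y. \<integral>\<^sup>+x. f (Complex x y) \<partial>lborel \<partial>lborel)"
    proof (rule nn_integral_cong)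
    show "(\<integral>\<^sup>+x. f (Complex (t * y + x) y) \<partial>lborel) = (\<integral>\<^sup>+x. f (Complex x y) \<partial>lborel)" for y
      using nn_integral_real_affine[of "\<lambda>x. f (Complex x y)" 1 "t * y"] by simp
  qed
  also have "\<dots> = (\<integral>\<^sup>+z. f z \<partial>lborel)"
    by (subst nn_integral_lborel_complex(2)) auto
  finally show "(\<integral>\<^sup>+z. f (Complex (Re z + t * Im z) (Im z)) \<partial>lborel) = (\<integral>\<^sup>+z. f z \<partial>lborel)" .
qed

text \<open>
  The factor \<open>c\<close> allows the shear to be combined with a reflection; \<open>c = -1\<close>, \<open>t = 0\<close> is complex
  conjugation.
\<close>

lemma preserves_area_shear_Im:
  assumes "\<bar>c\<bar> = 1"
  shows "preserves_area (\<lambda>z. Complex (Re z) (c * Im z + t * Re z))"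
proof (rule preserves_areaI)
  show [measurable]: "(\<lambda>z. Complex (Re z) (c * Im z + t * Re z)) \<in> borel_measurable borel"
    unfolding Complex_eq by measurable
  fix f :: "complex \<Rightarrow> ennreal" assume [measurable]: "f \<in> borel_measurable borel"
  have [measurable]: "Complex x \<in> borel_measurable borel" for x
    unfolding Complex_eq[abs_def] by measurable
  have "(\<integral>\<^sup>+z. f (Complex (Re z) (c * Im z + t * Re z)) \<partial>lborel)
      = (\<integral>\<^sup>+x. \<integral>\<^sup>+y. f (Complex x (t * x + c * y)) \<partial>lborel \<partial>lborel)"
    by (subst nn_integral_lborel_complex(1)) (auto simp: add.commute)
  also have "\<dots> = (\<integral>\<^sup>+x. \<integral>\<^sup>+y. f (Complex x y) \<partial>lborel \<partial>lborel)"
    proof (rule nn_integral_cong)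
    show "(\<integral>\<^sup>+y. f (Complex x (t * x + c * y)) \<partial>lborel) = (\<integral>\<^sup>+y. f (Complex x y) \<partial>lborel)" for x
      using nn_integral_real_affine[of "\<lambda>y. f (Complex x y)" c "t * x"] assms by auto
  qed
  also have "\<dots> = (\<integral>\<^sup>+z. f z \<partial>lborel)"
    by (subst nn_integral_lborel_complex(1)) auto
  finally show "(\<integral>\<^sup>+z. f (Complex (Re z) (c * Im z + t * Re z)) \<partial>lborel) = (\<integral>\<^sup>+z. f z \<partial>lborel)" .
qed

lemma preserves_area_cnj: "preserves_area cnj"
proof -
  have "(\<lambda>z. Complex (Re z) (-1 * Im z + 0 * Re z)) = cnj"
    by (auto simp: fun_eq_iff complex_eq_iff)
  with preserves_area_shear_Im[of "-1" 0] show ?thesis by simp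
qed

lemma preserves_area_rotation:
  assumes "cmod \<zeta> = 1"
  shows "preserves_area (\<lambda>z. \<zeta> * z)"
proof -
  have main: "preserves_area (\<lambda>z. \<omega> * z)" if \<omega>: "cmod \<omega> = 1" "Re \<omega> \<noteq> -1" for \<omega>
  proof -
    define x y t where "x = Re \<omega>" and "y = Im \<omega>" and "t = - y / (1 + x)"
    have "x\<^sup>2 + y\<^sup>2 = 1"
      using \<omega> by (simp add: x_def y_def cmod_def)
    have "1 + x \<noteq> 0" using \<omega> by (simp add: x_def)
    have "y * y = (1 - x) * (1 + x)"
      using \<open>x\<^sup>2 + y\<^sup>2 = 1\<close> by (simp add: algebra_simps power2_eq_square)
    then have 1: "t * y = x - 1"
      using \<open>1 + x \<noteq> 0\<close> unfolding t_def by (simp add: field_simps)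
    have 2: "t * x = - y - t"
      using \<open>1 + x \<noteq> 0\<close> unfolding t_def by (simp add: field_simps)
    \<comment> \<open>The entries of the product of a horizontal shear by \<open>t\<close>, a vertical one by \<open>y\<close>, and the first again.\<close>
    have 3: "u + t * v + t * (x * v + y * u) = x * u - y * v" for u v
      using 1 2 by algebra
    have 4: "v + y * (u + t * v) = x * v + y * u" for u v
      using 1 by algebra
    let ?R = "\<lambda>z. Complex (Re z + t * Im z) (Im z)"
    let ?S = "\<lambda>z. Complex (Re z) (1 * Im z + y * Re z)"
    have "preserves_area (\<lambda>z. ?R (?S (?R z)))"
      using preserves_area_comp[OF preserves_area_shear_Re[of t]
          preserves_area_comp[OF preserves_area_shear_Im[of 1 y] preserves_area_shear_Re[of t]]] by simp
    moreover have "(\<lambda>z. ?R (?S (?R z))) = (\<lambda>z. \<omega> * z)"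
      by (simp only: fun_eq_iff complex_eq_iff complex.sel times_complex.sel mult_1 4 3 x_def[symmetric] y_def[symmetric] simp_thms )
    ultimately show ?thesis by simp
  qed
  show ?thesis
  proof (cases "Re \<zeta> = -1")
    case True
    with assms have "Im \<zeta> = 0"
      by (simp add: cmod_def)
    \<comment> \<open>The half-turn has no such factorization, but it is the square of the quarter-turn.\<close>
    with True have "\<zeta> = \<i> * \<i>" by (simp add: complex_eq_iff)
    moreover have "preserves_area (\<lambda>z. \<i> * (\<i> * z))"
      by (rule preserves_area_comp[OF main main]) auto
    ultimately show ?thesis by (simp add: mult.assoc)
  qed (use main assms in blast)
qed

section \<open>The weighted measure of the disc and its moments\<close>

lemma space_bergman_measure [simp]: "space (bergman_measure \<alpha>) = unit_disc"
  by (simp add: bergman_measure_def space_restrict_space)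

lemma borel_measurable_bergman_measureI:
  "f \<in> borel_measurable borel \<Longrightarrow> f \<in> borel_measurable (bergman_measure \<alpha>)"
  by (simp add: bergman_measure_def measurable_restrict_space1)

lemma continuous_on_borel_measurable_bergman_measure:
  fixes f :: "complex \<Rightarrow> 'b :: real_normed_vector"
  assumes "continuous_on unit_disc f"
  shows "f \<in> borel_measurable (bergman_measure \<alpha>)"
proof -
  have "f \<in> borel_measurable (restrict_space borel unit_disc)"
    by (rule borel_measurable_continuous_on_restrict[OF assms])
  then show ?thesis
    by (simp add: bergman_measure_def measurable_def space_restrict_space sets_restrict_space)
qed

lemma nn_integral_bergman_measure:
  assumes "f \<in> borel_measurable (bergman_measure \<alpha>)"
  shows "(\<integral>\<^sup>+z. f z \<partial>bergman_measure \<alpha>)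
    = (\<integral>\<^sup>+z. ennreal ((\<alpha> + 1) * (1 - (cmod z)\<^sup>2) powr \<alpha> / pi) * f z * indicator unit_disc z \<partial>lborel)"
proof -
  have "f \<in> borel_measurable (restrict_space lborel unit_disc)"
    using assms by (simp add: bergman_measure_def)
  moreover have "(\<lambda>z. ennreal ((\<alpha> + 1) * (1 - (cmod z)\<^sup>2) powr \<alpha> / pi))
      \<in> borel_measurable (restrict_space lborel unit_disc)"
    by (intro measurable_restrict_space1) measurable
  ultimately show ?thesis
    unfolding bergman_measure_def by (subst nn_integral_density) (auto simp: nn_integral_restrict_space)
qed

text \<open>
  The weight depends only on the modulus, so a norm-preserving map that preserves area preserves
  the weighted measure.  Rotations give the orthogonality of the monomials, and
  \<open>z \<mapsto> cnj (\<eta> * z)\<close> gives the isometry of the conjugation.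
\<close>

lemma distr_bergman_measure:
  assumes R: "preserves_area R" and norm: "\<And>z. cmod (R z) = cmod z"
  shows "R \<in> measurable (bergman_measure \<alpha>) (bergman_measure \<alpha>)"
    and "distr (bergman_measure \<alpha>) (bergman_measure \<alpha>) R = bergman_measure \<alpha>"
proof -
  have [measurable]: "R \<in> borel_measurable borel"
    using R by (simp add: preserves_area_def)
  show meas: "R \<in> measurable (bergman_measure \<alpha>) (bergman_measure \<alpha>)"
    unfolding bergman_measure_def
    by (auto intro!: measurable_restrict_space3 simp: norm)
  show "distr (bergman_measure \<alpha>) (bergman_measure \<alpha>) R = bergman_measure \<alpha>"
  proof (rule measure_eqI)
    fix A assume "A \<in> sets (distr (bergman_measure \<alpha>) (bergman_measure \<alpha>) R)"
    then have A: "A \<in> sets (bergman_measure \<alpha>)" by simp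
    then have A': "A \<in> sets borel" "A \<subseteq> unit_disc"
      by (auto simp: bergman_measure_def sets_restrict_space)
    define G where "G z = ennreal ((\<alpha> + 1) * (1 - (cmod z)\<^sup>2) powr \<alpha> / pi) * indicator A z
      * indicator unit_disc z" for z
    have [measurable]: "A \<in> sets borel" by fact
    have G [measurable]: "G \<in> borel_measurable borel"
      unfolding G_def by (intro borel_measurable_times_ennreal borel_measurable_indicator) auto
    have "emeasure (distr (bergman_measure \<alpha>) (bergman_measure \<alpha>) R) A
        = (\<integral>\<^sup>+z. indicator A (R z) \<partial>bergman_measure \<alpha>)"
      using nn_integral_distr[OF meas, of "indicator A"] A by simp
    also have "\<dots> = (\<integral>\<^sup>+z. G (R z) \<partial>lborel)"
      by (subst nn_integral_bergman_measure)
        (auto simp: G_def norm indicator_def intro!: borel_measurable_bergman_measureI nn_integral_cong)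
    also have "\<dots> = (\<integral>\<^sup>+z. G z \<partial>distr lborel borel R)"
      by (simp add: nn_integral_distr)
    also have "\<dots> = (\<integral>\<^sup>+z. G z \<partial>lborel)"
      using R by (simp add: preserves_area_def)
    also have "\<dots> = (\<integral>\<^sup>+z. indicator A z \<partial>bergman_measure \<alpha>)"
      using A by (subst nn_integral_bergman_measure) (auto simp: G_def[abs_def])
    also have "\<dots> = emeasure (bergman_measure \<alpha>) A"
      using A by simp
    finally show "emeasure (distr (bergman_measure \<alpha>) (bergman_measure \<alpha>) R) A
        = emeasure (bergman_measure \<alpha>) A" .
  qed simp
qed

lemma integral_bergman_measure_invariant:
  fixes f :: "complex \<Rightarrow> 'b :: {banach, second_countable_topology}"
  assumes "preserves_area R" "\<And>z. cmod (R z) = cmod z" "f \<in> borel_measurable (bergman_measure \<alpha>)"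
  shows "(LINT z|bergman_measure \<alpha>. f (R z)) = (LINT z|bergman_measure \<alpha>. f z)"
    and "integrable (bergman_measure \<alpha>) (\<lambda>z. f (R z)) \<longleftrightarrow> integrable (bergman_measure \<alpha>) f"
  using integral_distr[OF distr_bergman_measure(1)[OF assms(1,2)] assms(3)]
    integrable_distr_eq[OF distr_bergman_measure(1)[OF assms(1,2)] assms(3)]
    distr_bergman_measure(2)[OF assms(1,2), of \<alpha>] by simp_all

text \<open>
  The disc of radius \<open>sqrt t\<close> has area \<open>pi * t\<close>, so \<open>\<bar>z\<bar>\<^sup>2\<close> is uniformly distributed.  This replaces
  polar coordinates: the integral of a radial function becomes an integral over the unit interval.
\<close>

lemma distr_norm_square_unit_disc:
  "distr (restrict_space lborel unit_disc) borel (\<lambda>z. (cmod z)\<^sup>2)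
    = density lborel (\<lambda>t. ennreal (pi * indicator {0<..<1} t))" (is "?M = ?N")
proof (rule measure_eqI_lessThan)
  have [measurable]: "(\<lambda>z. (cmod z)\<^sup>2) \<in> borel_measurable (restrict_space lborel unit_disc)"
    by (intro measurable_restrict_space1) measurable
  have vol: "emeasure lborel (unit_disc) = ennreal pi"
    by (subst emeasure_ball) (auto simp: unit_ball_vol_2)
  have N: "emeasure ?N {x<..} = ennreal pi * emeasure lborel ({0<..<1} \<inter> {x<..})" for x
  proof -
    have "emeasure ?N {x<..} = (\<integral>\<^sup>+t. ennreal pi * indicator ({0<..<1} \<inter> {x<..}) t \<partial>lborel)"
      by (subst emeasure_density) (auto simp: indicator_def intro!: nn_integral_cong)
    then show ?thesis by (simp add: nn_integral_cmult_indicator)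
  qed
  have M: "emeasure ?M {x<..} = emeasure lborel {z\<in>unit_disc. x < (cmod z)\<^sup>2}" for x
  proof -
    have "emeasure ?M {x<..} = emeasure (restrict_space lborel unit_disc) {z\<in>unit_disc. x < (cmod z)\<^sup>2}"
      by (subst emeasure_distr)
        (auto simp: space_restrict_space vimage_def Int_def conj_commute intro!: arg_cong2[where f = emeasure])
    also have "\<dots> = emeasure lborel {z\<in>unit_disc. x < (cmod z)\<^sup>2}"
      by (subst emeasure_restrict_space) auto
    finally show ?thesis .
  qed
  show "emeasure ?M {x<..} < \<infinity>" for x
  proof -
    have "emeasure ?M {x<..} \<le> emeasure lborel (unit_disc)"
      unfolding M by (intro emeasure_mono) auto
    also have "\<dots> < \<infinity>" by (simp add: vol)
    finally show ?thesis .
  qed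
  show "emeasure ?M {x<..} = emeasure ?N {x<..}" for x
  proof (cases "x < 0 \<or> 1 \<le> x")
    case True
    then show ?thesis
    proof
      assume "x < 0"
      then have "x < (cmod z)\<^sup>2" for z
        by (rule less_le_trans) simp
      then have "emeasure ?M {x<..} = ennreal pi"
        unfolding M vol[symmetric] by (simp add: ball_def)
      moreover have "{0<..<1} \<inter> {x<..} = {0<..<1}"
        using \<open>x < 0\<close> by (intro Int_absorb2 subsetI) auto
      ultimately show ?thesis unfolding N by simp
    next
      assume "1 \<le> x"
      have "\<not> x < (cmod z)\<^sup>2" if "cmod z < 1" for z
        using that \<open>1 \<le> x\<close> power_le_one[of "cmod z" 2] by simp
      then have "{z. cmod z < 1 \<and> x < (cmod z)\<^sup>2} = {}"
        by blast
      moreover from \<open>1 \<le> x\<close> have "{0<..<1} \<inter> {x<..} = {}" by auto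
      ultimately show ?thesis unfolding M N by (simp del: Collect_empty_eq)
    qed
  next
    case False
    have "x < (cmod z)\<^sup>2 \<longleftrightarrow> sqrt x < cmod z" for z
      using real_sqrt_less_iff[of x "(cmod z)\<^sup>2"] by simp
    then have "{z\<in>unit_disc. x < (cmod z)\<^sup>2} = {z\<in>unit_disc. sqrt x < cmod z}"
      by (simp only:)
    also have "\<dots> = unit_disc - cball 0 (sqrt x)"
      by (auto simp: not_le)
    finally have "emeasure ?M {x<..} = emeasure lborel (unit_disc - cball (0::complex) (sqrt x))"
      unfolding M by (rule arg_cong)
    also have "\<dots> = emeasure lborel (unit_disc) - emeasure lborel (cball (0::complex) (sqrt x))"
    proof (rule emeasure_Diff)
      show "cball 0 (sqrt x) \<subseteq> unit_disc"
        using False by (simp add: cball_subset_ball_iff)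
    qed (use emeasure_lborel_cball_finite[of "0::complex" "sqrt x"] in simp_all)
    also have "\<dots> = ennreal pi - ennreal (pi * x)"
      using False by (simp add: vol emeasure_cball unit_ball_vol_2)
    also have "\<dots> = ennreal (pi * (1 - x))"
      using False by (simp add: ennreal_minus algebra_simps)
    also have "\<dots> = ennreal pi * emeasure lborel {x<..<1}"
      using False by (simp add: ennreal_mult)
    also have "{x<..<1} = {0<..<1} \<inter> {x<..}"
      using False by auto
    finally show ?thesis by (simp add: N)
  qed
qed auto

text \<open>
  The squared norm of \<open>z ^ m\<close>; its reciprocals are the Taylor coefficients of the reproducing kernel
  \<open>(1 - x) powr - (\<alpha> + 2)\<close>.
\<close>

definition bergman_moment :: "real \<Rightarrow> nat \<Rightarrow> real" where
  "bergman_moment \<alpha> m = fact m / pochhammer (\<alpha> + 2) m"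

lemma bergman_moment_pos: "\<alpha> > -1 \<Longrightarrow> bergman_moment \<alpha> m > 0"
  unfolding bergman_moment_def by (intro divide_pos_pos pochhammer_pos) auto

lemma bergman_moment_eq_Beta:
  assumes "\<alpha> > -1"
  shows "bergman_moment \<alpha> m = (\<alpha> + 1) * Beta (real m + 1) (\<alpha> + 1)"
proof -
  have nz: "\<alpha> + 1 \<notin> \<int>\<^sub>\<le>\<^sub>0" "\<alpha> + 2 \<notin> \<int>\<^sub>\<le>\<^sub>0"
    using assms by (auto simp: nonpos_Ints_def)
  have "Beta (real m + 1) (\<alpha> + 1) = fact m * Gamma (\<alpha> + 1) / Gamma (\<alpha> + 2 + real m)"
    by (simp add: Beta_def Gamma_fact add_ac)
  moreover have "Gamma (\<alpha> + 2) = (\<alpha> + 1) * Gamma (\<alpha> + 1)"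
    using Gamma_plus1[OF nz(1)] by (simp add: add_ac)
  moreover have "pochhammer (\<alpha> + 2) m = Gamma (\<alpha> + 2 + real m) / Gamma (\<alpha> + 2)"
    by (rule pochhammer_Gamma[OF nz(2)])
  ultimately show ?thesis
    by (simp add: bergman_moment_def)
qed

text \<open>
  With \<open>t = \<bar>z\<bar>\<^sup>2\<close> the integral is Euler's Beta integral.
\<close>

lemma nn_integral_bergman_moment:
  assumes "\<alpha> > -1"
  shows "(\<integral>\<^sup>+z. ennreal (cmod z ^ (2 * m)) \<partial>bergman_measure \<alpha>) = ennreal (bergman_moment \<alpha> m)"
proof -
  define g where "g t = (\<alpha> + 1) * (1 - t) powr \<alpha> / pi * t ^ m" for t :: real
  have [measurable]: "g \<in> borel_measurable borel" unfolding g_def by measurable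
  have [measurable]: "(\<lambda>z. (cmod z)\<^sup>2) \<in> borel_measurable (restrict_space lborel unit_disc)"
    by (intro measurable_restrict_space1) measurable
  have "(\<integral>\<^sup>+z. ennreal (cmod z ^ (2 * m)) \<partial>bergman_measure \<alpha>)
      = (\<integral>\<^sup>+z. ennreal (g ((cmod z)\<^sup>2)) * indicator unit_disc z \<partial>lborel)"
    using assms
    by (subst nn_integral_bergman_measure)
      (auto simp: g_def power_mult ennreal_mult'[symmetric] ennreal_mult''[symmetric] intro!: borel_measurable_bergman_measureI nn_integral_cong)
  also have "\<dots> = (\<integral>\<^sup>+t. ennreal (g t) \<partial>distr (restrict_space lborel unit_disc) borel (\<lambda>z. (cmod z)\<^sup>2))"
    by (simp add: nn_integral_distr nn_integral_restrict_space)
  also have "\<dots> = (\<integral>\<^sup>+t. ennreal (pi * indicator {0<..<1} t) * ennreal (g t) \<partial>lborel)"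
    unfolding distr_norm_square_unit_disc by (simp add: nn_integral_density)
  also have "\<dots> = (\<integral>\<^sup>+t. ennreal (indicator {0<..<1} t * ((\<alpha> + 1) * (t powr (real m + 1 - 1) * (1 - t) powr (\<alpha> + 1 - 1)))) \<partial>lborel)"
    using assms
    by (intro nn_integral_cong) (auto simp: g_def indicator_def powr_realpow ennreal_mult'[symmetric] mult_ac)
  also have "\<dots> = ennreal ((\<alpha> + 1) * Beta (real m + 1) (\<alpha> + 1))"
  proof (rule nn_integral_has_integral_lborel)
    have "((\<lambda>t. t powr (real m + 1 - 1) * (1 - t) powr (\<alpha> + 1 - 1)) has_integral Beta (real m + 1) (\<alpha> + 1)) {0<..<1}"
      using has_integral_Beta_real[of "real m + 1" "\<alpha> + 1"] assms
      by (simp add: has_integral_Icc_iff_Ioo)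
    from has_integral_mult_right[OF this, of "\<alpha> + 1"]
    show "((\<lambda>t. indicator {0<..<1} t * ((\<alpha> + 1) * (t powr (real m + 1 - 1) * (1 - t) powr (\<alpha> + 1 - 1))))
        has_integral (\<alpha> + 1) * Beta (real m + 1) (\<alpha> + 1)) UNIV"
      by (subst (asm) has_integral_restrict_UNIV[symmetric], elim has_integral_eq[rotated]) auto
  qed (use assms in \<open>auto simp: indicator_def\<close>)
  finally show ?thesis
    by (simp add: bergman_moment_eq_Beta[OF assms])
qed

lemma finite_measure_bergman_measure: "\<alpha> > -1 \<Longrightarrow> finite_measure (bergman_measure \<alpha>)"
  using nn_integral_bergman_moment[of \<alpha> 0] by (intro finite_measureI) simp

lemma has_bochner_integral_bergman_moment:
  assumes "\<alpha> > -1"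
  shows "has_bochner_integral (bergman_measure \<alpha>) (\<lambda>z. cmod z ^ (2 * m)) (bergman_moment \<alpha> m)"
  using nn_integral_bergman_moment[OF assms, of m] bergman_moment_pos[OF assms, of m]
  by (intro has_bochner_integral_nn_integral borel_measurable_bergman_measureI) auto

section \<open>Taylor coefficients and integrals over smaller discs\<close>

definition taylor_coeff :: "(complex \<Rightarrow> complex) \<Rightarrow> nat \<Rightarrow> complex" where
  "taylor_coeff f m = (deriv ^^ m) f 0 / fact m"

lemma taylor_coeff_sums:
  "f holomorphic_on unit_disc \<Longrightarrow> z \<in> unit_disc \<Longrightarrow> (\<lambda>m. taylor_coeff f m * z ^ m) sums f z"
  using holomorphic_power_series[of f 0 1 z] by (simp add: taylor_coeff_def)

lemma summable_norm_taylor_coeff: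
  assumes "f holomorphic_on unit_disc" "0 \<le> r" "r < 1"
  shows "summable (\<lambda>m. cmod (taylor_coeff f m) * r ^ m)"
proof -
  have norm: "cmod (of_real ((1 + r) / 2)) = (1 + r) / 2"
    using assms(2) by (subst norm_of_real) simp
  then have "of_real ((1 + r) / 2) \<in> unit_disc"
    using assms(3) unfolding mem_ball dist_0_norm norm by simp
  then have "summable (\<lambda>m. taylor_coeff f m * of_real ((1 + r) / 2) ^ m)"
    by (rule sums_summable[OF taylor_coeff_sums[OF assms(1)]])
  moreover have "norm (complex_of_real r) < norm (complex_of_real ((1 + r) / 2))"
    unfolding norm using assms(2,3) by simp
  ultimately have "summable (\<lambda>m. cmod (taylor_coeff f m * of_real r ^ m))"
    by (rule powser_insidea)
  then show ?thesis
    using assms(2) by (simp add: norm_mult norm_power)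
qed

text \<open>
  Term-by-term integration against a power series converging absolutely on the closed disc of
  radius \<open>r\<close>.  It is used with \<open>r < 1\<close> and \<open>h\<close> cut off outside that disc, where every Taylor series
  qualifies, and with \<open>r = 1\<close> for the expansions of the kernels.
\<close>

lemma integral_mult_power_series:
  fixes h g :: "complex \<Rightarrow> complex" and b :: "nat \<Rightarrow> complex"
  assumes h: "integrable (bergman_measure \<alpha>) h"
    and outside: "\<And>z. z \<in> unit_disc \<Longrightarrow> r < cmod z \<Longrightarrow> h z = 0"
    and b: "summable (\<lambda>m. cmod (b m) * r ^ m)" and r: "0 \<le> r"
    and g: "\<And>z. z \<in> unit_disc \<Longrightarrow> cmod z \<le> r \<Longrightarrow> (\<lambda>m. b m * z ^ m) sums g z"
  shows "(\<lambda>m. b m * (LINT z|bergman_measure \<alpha>. h z * z ^ m)) sums (LINT z|bergman_measure \<alpha>. h z * g z)"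
proof -
  let ?M = "bergman_measure \<alpha>"
  let ?f = "\<lambda>m z. h z * (b m * z ^ m)"
  have bound: "norm (?f m z) \<le> (cmod (b m) * r ^ m) * norm (h z)" if "z \<in> unit_disc" for m z
  proof (cases "cmod z \<le> r")
    case True
    then have "cmod z ^ m \<le> r ^ m" by (intro power_mono) auto
    then have "cmod (h z) * cmod (b m) * cmod z ^ m \<le> cmod (h z) * cmod (b m) * r ^ m"
      by (intro mult_left_mono) auto
    then show ?thesis by (simp add: norm_mult norm_power mult_ac)
  qed (use outside[OF that] in simp)
  have [measurable]: "h \<in> borel_measurable ?M" using h by simp
  have [measurable]: "(\<lambda>z. z ^ m) \<in> borel_measurable ?M" for m :: nat
    by (intro borel_measurable_bergman_measureI) measurable
  have int: "integrable ?M (?f m)" for m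
  proof (rule Bochner_Integration.integrable_bound)
    show "integrable ?M (\<lambda>z. (cmod (b m) * r ^ m) * norm (h z))"
      using h by simp
    show "AE z in ?M. norm (?f m z) \<le> norm ((cmod (b m) * r ^ m) * norm (h z))"
      using bound r by (intro AE_I2) (simp add: norm_mult)
  qed measurable
  have summ: "summable (\<lambda>m. norm (?f m z))" if "z \<in> unit_disc" for z
    by (rule summable_comparison_test'[of "\<lambda>m. (cmod (b m) * r ^ m) * norm (h z)" 0])
      (use bound[OF that] b in \<open>auto intro: summable_mult2\<close>)
  have "(\<lambda>m. integral\<^sup>L ?M (?f m)) sums (LINT z|?M. (\<Sum>m. ?f m z))"
  proof (rule sums_integral)
    show "summable (\<lambda>m. LINT z|?M. norm (?f m z))"
    proof (rule summable_comparison_test'[of "\<lambda>m. (cmod (b m) * r ^ m) * (LINT z|?M. norm (h z))" 0])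
      show "norm (LINT z|?M. norm (?f m z)) \<le> (cmod (b m) * r ^ m) * (LINT z|?M. norm (h z))" for m
      proof -
        have "(LINT z|?M. norm (?f m z)) \<le> (LINT z|?M. (cmod (b m) * r ^ m) * norm (h z))"
          using int h bound by (intro integral_mono) auto
        then show ?thesis by simp
      qed
    qed (use b in \<open>auto intro: summable_mult2\<close>)
  qed (use int summ in auto)
  moreover have "(LINT z|?M. (\<Sum>m. ?f m z)) = (LINT z|?M. h z * g z)"
  proof (rule Bochner_Integration.integral_cong)
    fix z assume "z \<in> space ?M"
    then have z: "z \<in> unit_disc" by simp
    show "(\<Sum>m. ?f m z) = h z * g z"
    proof (cases "cmod z \<le> r")
      case True
      from sums_mult[OF g[OF z this], of "h z"] show ?thesis
        by (simp add: sums_iff)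
    qed (use outside[OF z] in simp)
  qed simp
  moreover have "integral\<^sup>L ?M (?f m) = b m * (LINT z|?M. h z * z ^ m)" for m
    by (subst integral_mult_right_zero[symmetric]) (simp add: mult_ac)
  ultimately show ?thesis by simp
qed

text \<open>
  The Taylor series of an element of the space need not converge absolutely up to the unit circle,
  so integrals are first cut off to a disc of radius \<open>r < 1\<close>.
\<close>

lemma integrable_truncated:
  fixes f :: "complex \<Rightarrow> 'b :: {banach, second_countable_topology, real_normed_algebra_1}"
  assumes "\<alpha> > -1" "continuous_on unit_disc f" "r < 1"
  shows "integrable (bergman_measure \<alpha>) (\<lambda>z. indicator (ball 0 r) z * f z)"
proof -
  interpret finite_measure "bergman_measure \<alpha>"
    using assms(1) by (rule finite_measure_bergman_measure)
  have "compact (f ` cball 0 r)"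
    by (intro compact_continuous_image continuous_on_subset[OF assms(2)]) (use assms(3) in auto)
  then obtain B where B: "\<And>z. z \<in> cball 0 r \<Longrightarrow> norm (f z) \<le> B"
    by (meson compact_imp_bounded bounded_iff image_eqI)
  show ?thesis
  proof (rule integrable_const_bound)
    show "AE z in bergman_measure \<alpha>. norm (indicator (ball 0 r) z * f z) \<le> \<bar>B\<bar>"
      using B by (intro AE_I2) (auto simp: indicator_def intro: order.trans[OF _ abs_ge_self])
    have "(indicator (ball 0 r) :: complex \<Rightarrow> 'b) \<in> borel_measurable (bergman_measure \<alpha>)"
      by (intro borel_measurable_bergman_measureI borel_measurable_indicator) simp
    then show "(\<lambda>z. indicator (ball 0 r) z * f z) \<in> borel_measurable (bergman_measure \<alpha>)"
      using continuous_on_borel_measurable_bergman_measure[OF assms(2)] 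
      by (intro borel_measurable_times)
  qed
qed

lemma integral_truncated_tendsto:
  fixes f :: "complex \<Rightarrow> 'b :: {banach, second_countable_topology, real_normed_algebra_1}"
  assumes f: "integrable (bergman_measure \<alpha>) f"
  shows "(\<lambda>j. LINT z|bergman_measure \<alpha>. indicator (ball 0 (real j / (real j + 1))) z * f z)
    \<longlonglongrightarrow> (LINT z|bergman_measure \<alpha>. f z)"
proof (rule integral_dominated_convergence[where w = "\<lambda>z. norm (f z)"])
  have "(indicator (ball 0 r) :: complex \<Rightarrow> 'b) \<in> borel_measurable (bergman_measure \<alpha>)" for r
    by (intro borel_measurable_bergman_measureI borel_measurable_indicator) simp
  then show "(\<lambda>z. indicator (ball 0 (real j / (real j + 1))) z * f z) \<in> borel_measurable (bergman_measure \<alpha>)" for j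
    using f by (intro borel_measurable_times) auto
  have lim: "(\<lambda>j. real j / (real j + 1)) \<longlonglongrightarrow> 1"
    using LIMSEQ_n_over_Suc_n[where 'a = real] by (simp add: add.commute)
  show "AE z in bergman_measure \<alpha>. (\<lambda>j. indicator (ball 0 (real j / (real j + 1))) z * f z) \<longlonglongrightarrow> f z"
  proof (rule AE_I2)
    fix z assume "z \<in> space (bergman_measure \<alpha>)"
    then have "cmod z < 1" by simp
    then have "\<forall>\<^sub>F j in sequentially. cmod z < real j / (real j + 1)"
      by (rule order_tendstoD(1)[OF lim])
    then have "\<forall>\<^sub>F j in sequentially. indicator (ball 0 (real j / (real j + 1))) z * f z = f z"
      by eventually_elim simp
    then show "(\<lambda>j. indicator (ball 0 (real j / (real j + 1))) z * f z) \<longlonglongrightarrow> f z"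
      by (rule tendsto_eventually)
  qed
qed (use f in \<open>auto simp: indicator_def\<close>)

definition truncated_moment :: "real \<Rightarrow> real \<Rightarrow> nat \<Rightarrow> real" where
  "truncated_moment \<alpha> r m = (LINT z|bergman_measure \<alpha>. indicator (ball 0 r) z * cmod z ^ (2 * m))"

lemma truncated_moment_tendsto:
  "\<alpha> > -1 \<Longrightarrow> (\<lambda>j. truncated_moment \<alpha> (real j / (real j + 1)) m) \<longlonglongrightarrow> bergman_moment \<alpha> m"
  using has_bochner_integral_bergman_moment[of \<alpha> m]
    integral_truncated_tendsto[of \<alpha> "\<lambda>z. cmod z ^ (2 * m)"]
  by (simp add: truncated_moment_def has_bochner_integral_iff)

lemma truncated_moment_bounds:
  assumes "\<alpha> > -1" "r < 1"
  shows "0 \<le> truncated_moment \<alpha> r m" "truncated_moment \<alpha> r m \<le> bergman_moment \<alpha> m"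
proof -
  have *: "integrable (bergman_measure \<alpha>) (\<lambda>z. cmod z ^ (2 * m))"
    "(LINT z|bergman_measure \<alpha>. cmod z ^ (2 * m)) = bergman_moment \<alpha> m"
    using has_bochner_integral_bergman_moment[OF assms(1), of m] by (simp_all add: has_bochner_integral_iff)
  show "0 \<le> truncated_moment \<alpha> r m"
    unfolding truncated_moment_def by (intro integral_nonneg_AE) auto
  show "truncated_moment \<alpha> r m \<le> bergman_moment \<alpha> m"
    unfolding truncated_moment_def *(2)[symmetric]
    by (intro integral_mono integrable_truncated assms * continuous_intros) (auto simp: indicator_def)
qed

lemma integral_truncated_monomials:
  assumes "\<alpha> > -1" "r < 1"
  shows "(LINT z|bergman_measure \<alpha>. indicator (ball 0 r) z * (cnj z ^ m * z ^ k))
    = (if k = m then of_real (truncated_moment \<alpha> r m) else 0)"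
proof (cases "k = m")
  case True
  have "cnj z ^ m * z ^ m = of_real (cmod z ^ (2 * m))" for z
    by (metis complex_norm_square mult.commute of_real_power power_mult power_mult_distrib)
  then have "(LINT z|bergman_measure \<alpha>. indicator (ball 0 r) z * (cnj z ^ m * z ^ m))
      = (LINT z|bergman_measure \<alpha>. complex_of_real (indicator (ball 0 r) z * cmod z ^ (2 * m)))"
    by (intro Bochner_Integration.integral_cong) (auto simp: indicator_def)
  then show ?thesis
    using True by (simp add: truncated_moment_def del: of_real_mult of_real_power)
next
  case False
  \<comment> \<open>This rotation multiplies the integrand by \<open>-1\<close>, so the integral equals its own negative.\<close>
  define t where "t = pi / (real k - real m)"
  define F where "F z = indicator (ball 0 r) z * (cnj z ^ m * z ^ k)" for z :: complex
  have F: "F \<in> borel_measurable (bergman_measure \<alpha>)"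
    unfolding F_def[abs_def] by (intro borel_measurable_integrable integrable_truncated assms continuous_intros)
  have "cnj (cis t) ^ m * cis t ^ k = cis ((real k - real m) * t)"
    unfolding cis_cnj Complex.DeMoivre cis_mult by (simp add: algebra_simps)
  also have "\<dots> = -1"
    using False by (simp add: t_def)
  finally have minus1: "cnj (cis t) ^ m * cis t ^ k = -1" .
  have "F (cis t * z) = - F z" for z
  proof -
    have "F (cis t * z) = (cnj (cis t) ^ m * cis t ^ k) * F z"
      by (simp add: F_def indicator_def norm_mult power_mult_distrib mult_ac)
    with minus1 show ?thesis by simp
  qed
  then have "integral\<^sup>L (bergman_measure \<alpha>) F = - integral\<^sup>L (bergman_measure \<alpha>) F"
    using integral_bergman_measure_invariant(1)[OF preserves_area_rotation, of "cis t" F \<alpha>] F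
    by (simp add: norm_mult)
  then show ?thesis
    using False by (simp add: F_def[abs_def])
qed

text \<open>
  On the smaller disc the Taylor series of \<open>f\<close> may be integrated term by term, and orthogonality
  leaves only the term of degree \<open>m\<close>.
\<close>

lemma integral_truncated_monomial:
  assumes "\<alpha> > -1" "f holomorphic_on unit_disc" "0 \<le> r" "r < 1"
  shows "(LINT z|bergman_measure \<alpha>. indicator (ball 0 r) z * (cnj z ^ m * f z))
    = taylor_coeff f m * of_real (truncated_moment \<alpha> r m)"
proof -
  let ?h = "\<lambda>z. indicator (ball 0 r) z * cnj z ^ m"
  have "(\<lambda>k. taylor_coeff f k * (LINT z|bergman_measure \<alpha>. ?h z * z ^ k))
      sums (LINT z|bergman_measure \<alpha>. ?h z * f z)"
  proof (rule integral_mult_power_series)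
    show "integrable (bergman_measure \<alpha>) ?h"
      by (intro integrable_truncated assms continuous_intros)
  qed (use assms summable_norm_taylor_coeff taylor_coeff_sums in auto)
  moreover have "taylor_coeff f k * (LINT z|bergman_measure \<alpha>. ?h z * z ^ k)
      = (if k = m then taylor_coeff f m * of_real (truncated_moment \<alpha> r m) else 0)" for k
    using integral_truncated_monomials[OF assms(1,4), of m k] by (simp add: mult.assoc)
  ultimately have "(\<lambda>k. if k = m then taylor_coeff f m * of_real (truncated_moment \<alpha> r m) else 0)
      sums (LINT z|bergman_measure \<alpha>. ?h z * f z)"
    by simp
  with sums_single[of m "\<lambda>k. taylor_coeff f m * of_real (truncated_moment \<alpha> r m)"] show ?thesis
    by (simp add: sums_iff mult.assoc)
qed

text \<open>
  Expanding one factor of \<open>\<bar>f z\<bar>\<^sup>2 = f z * cnj (f z)\<close> reduces this to the previous lemma.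
\<close>

lemma truncated_Parseval:
  assumes "\<alpha> > -1" "f holomorphic_on unit_disc" "0 \<le> r" "r < 1"
  shows "(\<lambda>m. (cmod (taylor_coeff f m))\<^sup>2 * truncated_moment \<alpha> r m)
    sums (LINT z|bergman_measure \<alpha>. indicator (ball 0 r) z * (cmod (f z))\<^sup>2)"
proof -
  let ?h = "\<lambda>z. indicator (ball 0 r) z * cnj (f z)"
  have cont: "continuous_on unit_disc f"
    using assms(2) by (rule holomorphic_on_imp_continuous_on)
  have "(\<lambda>m. taylor_coeff f m * (LINT z|bergman_measure \<alpha>. ?h z * z ^ m))
      sums (LINT z|bergman_measure \<alpha>. ?h z * f z)"
  proof (rule integral_mult_power_series)
    show "integrable (bergman_measure \<alpha>) ?h"
      by (intro integrable_truncated assms continuous_intros cont)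
  qed (use assms summable_norm_taylor_coeff taylor_coeff_sums in auto)
  moreover have "(LINT z|bergman_measure \<alpha>. ?h z * z ^ m) = cnj (taylor_coeff f m) * of_real (truncated_moment \<alpha> r m)" for m
  proof -
    have "(LINT z|bergman_measure \<alpha>. ?h z * z ^ m)
        = (LINT z|bergman_measure \<alpha>. cnj (indicator (ball 0 r) z * (cnj z ^ m * f z)))"
      by (intro Bochner_Integration.integral_cong) (auto simp: indicator_def)
    also have "\<dots> = cnj (LINT z|bergman_measure \<alpha>. indicator (ball 0 r) z * (cnj z ^ m * f z))"
      by (rule Bochner_Integration.integral_cnj)
    finally show ?thesis
      unfolding integral_truncated_monomial[OF assms] by simp
  qed
  moreover have "(LINT z|bergman_measure \<alpha>. ?h z * f z)
      = (LINT z|bergman_measure \<alpha>. complex_of_real (indicator (ball 0 r) z * (cmod (f z))\<^sup>2))"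
    by (intro Bochner_Integration.integral_cong) (auto simp: indicator_def complex_norm_square mult_ac simp del: of_real_power)
  moreover have norm_sq: "taylor_coeff f m * (cnj (taylor_coeff f m) * of_real t)
      = complex_of_real ((cmod (taylor_coeff f m))\<^sup>2 * t)" for m t
    by (simp add: complex_norm_square mult.assoc del: of_real_power)
  ultimately have "(\<lambda>m. complex_of_real ((cmod (taylor_coeff f m))\<^sup>2 * truncated_moment \<alpha> r m))
    sums complex_of_real (LINT z|bergman_measure \<alpha>. indicator (ball 0 r) z * (cmod (f z))\<^sup>2)"
    by (simp only: norm_sq integral_complex_of_real)
  then show ?thesis by (simp only: sums_of_real_iff)
qed

section \<open>The inner product and the density of polynomials\<close>

lemma bergman_spaceD:
  assumes "f \<in> bergman_space \<alpha>"
  shows "f holomorphic_on unit_disc" "z \<notin> unit_disc \<Longrightarrow> f z = 0"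
    "integrable (bergman_measure \<alpha>) (\<lambda>z. (cmod (f z))\<^sup>2)"
    "f \<in> borel_measurable (bergman_measure \<alpha>)"
  using assms
  by (auto simp: bergman_space_def
      intro!: continuous_on_borel_measurable_bergman_measure holomorphic_on_imp_continuous_on)

lemma integrable_bergman_space_mult_cnj:
  assumes "f \<in> bergman_space \<alpha>" "g \<in> bergman_space \<alpha>"
  shows "integrable (bergman_measure \<alpha>) (\<lambda>z. f z * cnj (g z))"
proof (rule Bochner_Integration.integrable_bound)
  show "integrable (bergman_measure \<alpha>) (\<lambda>z. (cmod (f z))\<^sup>2 + (cmod (g z))\<^sup>2)"
    by (intro Bochner_Integration.integrable_add bergman_spaceD[OF assms(1)] bergman_spaceD[OF assms(2)])
  have "x * y \<le> x\<^sup>2 + y\<^sup>2" if "x \<ge> 0" "y \<ge> 0" for x y :: real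
    using sum_squares_bound[of x y] mult_nonneg_nonneg[OF that] by linarith
  then show "AE z in bergman_measure \<alpha>. norm (f z * cnj (g z)) \<le> norm ((cmod (f z))\<^sup>2 + (cmod (g z))\<^sup>2)"
    by (intro AE_I2) (simp add: norm_mult)
  have [measurable]: "f \<in> borel_measurable (bergman_measure \<alpha>)" "g \<in> borel_measurable (bergman_measure \<alpha>)"
    using assms by (simp_all add: bergman_spaceD)
  have [measurable]: "cnj \<in> borel_measurable borel"
    by (intro borel_measurable_continuous_onI continuous_intros)
  show "(\<lambda>z. f z * cnj (g z)) \<in> borel_measurable (bergman_measure \<alpha>)"
    by measurable
qed

lemma bergman_space_lincomb:
  assumes "f \<in> bergman_space \<alpha>" "g \<in> bergman_space \<alpha>"
  shows "(\<lambda>z. a * f z + b * g z) \<in> bergman_space \<alpha>"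
proof -
  have "integrable (bergman_measure \<alpha>) (\<lambda>z. (cmod (a * f z + b * g z))\<^sup>2)"
  proof (rule Bochner_Integration.integrable_bound)
    show "integrable (bergman_measure \<alpha>) (\<lambda>z. 2 * (cmod a)\<^sup>2 * (cmod (f z))\<^sup>2 + 2 * (cmod b)\<^sup>2 * (cmod (g z))\<^sup>2)"
      by (intro Bochner_Integration.integrable_add integrable_mult_right
          bergman_spaceD[OF assms(1)] bergman_spaceD[OF assms(2)])
    have "(cmod (a * x + b * y))\<^sup>2 \<le> 2 * (cmod a)\<^sup>2 * (cmod x)\<^sup>2 + 2 * (cmod b)\<^sup>2 * (cmod y)\<^sup>2" for x y
    proof -
      have "(cmod (a * x + b * y))\<^sup>2 \<le> (cmod (a * x) + cmod (b * y))\<^sup>2"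
        by (intro power_mono norm_triangle_ineq) auto
      also have "\<dots> \<le> 2 * (cmod (a * x))\<^sup>2 + 2 * (cmod (b * y))\<^sup>2"
        using sum_squares_bound[of "cmod (a * x)" "cmod (b * y)"] by (simp add: power2_sum)
      finally show ?thesis by (simp add: norm_mult power_mult_distrib)
    qed
    then show "AE z in bergman_measure \<alpha>. norm ((cmod (a * f z + b * g z))\<^sup>2)
        \<le> norm (2 * (cmod a)\<^sup>2 * (cmod (f z))\<^sup>2 + 2 * (cmod b)\<^sup>2 * (cmod (g z))\<^sup>2)"
      by (intro AE_I2) simp
    have [measurable]: "f \<in> borel_measurable (bergman_measure \<alpha>)" "g \<in> borel_measurable (bergman_measure \<alpha>)"
      using assms by (simp_all add: bergman_spaceD)
    show "(\<lambda>z. (cmod (a * f z + b * g z))\<^sup>2) \<in> borel_measurable (bergman_measure \<alpha>)"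
      by measurable
  qed
  then show ?thesis
    using assms by (auto simp: bergman_space_def intro!: holomorphic_intros)
qed

lemma bounded_holomorphic_in_bergman_space:
  assumes "\<alpha> > -1" "f holomorphic_on unit_disc" "\<And>z. z \<notin> unit_disc \<Longrightarrow> f z = 0"
    and B: "\<And>z. z \<in> unit_disc \<Longrightarrow> cmod (f z) \<le> B"
  shows "f \<in> bergman_space \<alpha>"
proof -
  interpret finite_measure "bergman_measure \<alpha>"
    using assms(1) by (rule finite_measure_bergman_measure)
  have [measurable]: "f \<in> borel_measurable (bergman_measure \<alpha>)"
    by (intro continuous_on_borel_measurable_bergman_measure holomorphic_on_imp_continuous_on assms)
  have "integrable (bergman_measure \<alpha>) (\<lambda>z. (cmod (f z))\<^sup>2)"
  proof (rule integrable_const_bound)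
    show "AE z in bergman_measure \<alpha>. norm ((cmod (f z))\<^sup>2) \<le> B\<^sup>2"
      using B by (intro AE_I2) (simp add: power_mono)
  qed measurable
  then show ?thesis
    using assms by (simp add: bergman_space_def)
qed

text \<open>
  Elements of the space vanish outside the disc, so the power function is cut off there.
\<close>

definition bergman_monomial :: "nat \<Rightarrow> complex \<Rightarrow> complex" where
  "bergman_monomial m z = (if z \<in> unit_disc then z ^ m else 0)"

lemma bergman_monomial_in_space: "\<alpha> > -1 \<Longrightarrow> bergman_monomial m \<in> bergman_space \<alpha>"
proof (rule bounded_holomorphic_in_bergman_space[where B = 1])
  show "bergman_monomial m holomorphic_on unit_disc"
    by (rule holomorphic_transform[of "\<lambda>z. z ^ m"])
      (auto simp: bergman_monomial_def intro!: holomorphic_intros)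
qed (auto simp: bergman_monomial_def norm_power intro!: power_le_one)

lemma bergman_space_zero: "(\<lambda>z. 0) \<in> bergman_space \<alpha>"
  by (simp add: bergman_space_def)

lemma bergman_space_sum:
  assumes "\<And>i. i \<in> I \<Longrightarrow> f i \<in> bergman_space \<alpha>"
  shows "(\<lambda>z. \<Sum>i\<in>I. c i * f i z) \<in> bergman_space \<alpha>"
  using assms
proof (induction I rule: infinite_finite_induct)
  case (insert i I)
  have "(\<lambda>z. c i * f i z + 1 * (\<Sum>i\<in>I. c i * f i z)) \<in> bergman_space \<alpha>"
    using insert by (intro bergman_space_lincomb) auto
  then show ?case using insert by simp
qed (simp_all add: bergman_space_zero)

lemma bergman_ip_lincomb:
  assumes "f \<in> bergman_space \<alpha>" "g \<in> bergman_space \<alpha>" "h \<in> bergman_space \<alpha>"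
  shows "bergman_ip \<alpha> (\<lambda>z. a * f z + b * g z) h = a * bergman_ip \<alpha> f h + b * bergman_ip \<alpha> g h"
proof -
  have "bergman_ip \<alpha> (\<lambda>z. a * f z + b * g z) h
      = (LINT z|bergman_measure \<alpha>. a * (f z * cnj (h z)) + b * (g z * cnj (h z)))"
    unfolding bergman_ip_def by (intro Bochner_Integration.integral_cong) (auto simp: algebra_simps)
  also have "\<dots> = a * bergman_ip \<alpha> f h + b * bergman_ip \<alpha> g h"
    using assms by (simp add: bergman_ip_def integrable_bergman_space_mult_cnj)
  finally show ?thesis .
qed

lemma cnj_bergman_ip: "cnj (bergman_ip \<alpha> f g) = bergman_ip \<alpha> g f"
  unfolding bergman_ip_def
  by (subst Bochner_Integration.integral_cnj[symmetric]) (simp add: mult.commute)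

lemma bergman_ip_lincomb_right:
  assumes "f \<in> bergman_space \<alpha>" "g \<in> bergman_space \<alpha>" "h \<in> bergman_space \<alpha>"
  shows "bergman_ip \<alpha> h (\<lambda>z. a * f z + b * g z) = cnj a * bergman_ip \<alpha> h f + cnj b * bergman_ip \<alpha> h g"
  using bergman_ip_lincomb[OF assms, of a b]
  by (metis cnj_bergman_ip complex_cnj_add complex_cnj_mult)

lemma bergman_ip_self: "bergman_ip \<alpha> f f = of_real (LINT z|bergman_measure \<alpha>. (cmod (f z))\<^sup>2)"
  unfolding bergman_ip_def
  by (subst integral_complex_of_real[symmetric]) (simp add: complex_norm_square del: of_real_power)

lemma ip_norm_bergman: "ip_norm (bergman_ip \<alpha>) f = sqrt (LINT z|bergman_measure \<alpha>. (cmod (f z))\<^sup>2)"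
  by (simp add: ip_norm_def bergman_ip_self)

lemma ip_norm_bergman_nonneg: "0 \<le> ip_norm (bergman_ip \<alpha>) f"
  by (simp add: ip_norm_bergman)

lemma bergman_Cauchy_Schwarz:
  assumes "f \<in> bergman_space \<alpha>" "g \<in> bergman_space \<alpha>"
  shows "cmod (bergman_ip \<alpha> f g) \<le> ip_norm (bergman_ip \<alpha>) f * ip_norm (bergman_ip \<alpha>) g"
proof -
  let ?M = "bergman_measure \<alpha>"
  note [measurable] = bergman_spaceD(4)[OF assms(1)] bergman_spaceD(4)[OF assms(2)]
  let ?I = "LINT z|?M. cmod (f z) * cmod (g z)"
  have int: "integrable ?M (\<lambda>z. cmod (f z) * cmod (g z))"
    using integrable_norm[OF integrable_bergman_space_mult_cnj[OF assms]] by (simp add: norm_mult)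
  have I: "0 \<le> ?I" by simp
  have "ennreal (?I\<^sup>2) = (\<integral>\<^sup>+z. ennreal (cmod (f z)) * ennreal (cmod (g z)) \<partial>?M)\<^sup>2"
    using I by (simp add: nn_integral_eq_integral[OF int] ennreal_power flip: ennreal_mult)
  also have "\<dots> \<le> (\<integral>\<^sup>+z. (ennreal (cmod (f z)))\<^sup>2 \<partial>?M) * (\<integral>\<^sup>+z. (ennreal (cmod (g z)))\<^sup>2 \<partial>?M)"
    by (rule Cauchy_Schwarz_nn_integral) measurable
  also have "\<dots> = ennreal ((LINT z|?M. (cmod (f z))\<^sup>2) * (LINT z|?M. (cmod (g z))\<^sup>2))"
    using bergman_spaceD(3)[OF assms(1)] bergman_spaceD(3)[OF assms(2)]
    by (simp add: ennreal_power nn_integral_eq_integral ennreal_mult)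
  finally have "?I\<^sup>2 \<le> (LINT z|?M. (cmod (f z))\<^sup>2) * (LINT z|?M. (cmod (g z))\<^sup>2)"
    by (simp add: ennreal_le_iff)
  then have "?I \<le> ip_norm (bergman_ip \<alpha>) f * ip_norm (bergman_ip \<alpha>) g"
    by (simp add: ip_norm_bergman real_le_rsqrt flip: real_sqrt_mult)
  moreover have "cmod (bergman_ip \<alpha> f g) \<le> ?I"
    unfolding bergman_ip_def
    using integral_norm_bound[of ?M "\<lambda>z. f z * cnj (g z)"] by (simp add: norm_mult)
  ultimately show ?thesis by linarith
qed

text \<open>
  The formula on the disc of radius \<open>r < 1\<close> passes to the limit \<open>r = 1\<close> by dominated convergence.
\<close>

lemma bergman_ip_monomial:
  assumes "\<alpha> > -1" "f \<in> bergman_space \<alpha>"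
  shows "bergman_ip \<alpha> f (bergman_monomial m) = taylor_coeff f m * of_real (bergman_moment \<alpha> m)"
proof -
  let ?F = "\<lambda>z. cnj (z ^ m) * f z"
  have eq: "f z * cnj (bergman_monomial m z) = ?F z" if "z \<in> unit_disc" for z
    using that by (simp add: bergman_monomial_def)
  have int: "integrable (bergman_measure \<alpha>) ?F"
    using integrable_bergman_space_mult_cnj[OF assms(2) bergman_monomial_in_space[OF assms(1)], of m]
    by (rule Bochner_Integration.integrable_cong[THEN iffD1, rotated -1]) (auto simp: eq)
  have "(\<lambda>j. taylor_coeff f m * of_real (truncated_moment \<alpha> (real j / (real j + 1)) m))
      \<longlonglongrightarrow> integral\<^sup>L (bergman_measure \<alpha>) ?F"
    using integral_truncated_tendsto[OF int] assms(1) bergman_spaceD(1)[OF assms(2)]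
    by (simp add: integral_truncated_monomial)
  moreover have "(\<lambda>j. taylor_coeff f m * of_real (truncated_moment \<alpha> (real j / (real j + 1)) m))
      \<longlonglongrightarrow> taylor_coeff f m * of_real (bergman_moment \<alpha> m)"
    by (intro tendsto_intros truncated_moment_tendsto assms)
  ultimately have "integral\<^sup>L (bergman_measure \<alpha>) ?F = taylor_coeff f m * of_real (bergman_moment \<alpha> m)"
    by (rule LIMSEQ_unique)
  then show ?thesis
    unfolding bergman_ip_def
    by (subst Bochner_Integration.integral_cong[OF refl eq]) auto
qed

definition taylor_poly :: "(complex \<Rightarrow> complex) \<Rightarrow> nat \<Rightarrow> complex \<Rightarrow> complex" where
  "taylor_poly f N z = (\<Sum>m<N. taylor_coeff f m * bergman_monomial m z)"

lemma taylor_poly_in_space: "\<alpha> > -1 \<Longrightarrow> taylor_poly f N \<in> bergman_space \<alpha>"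
  unfolding taylor_poly_def[abs_def] by (intro bergman_space_sum bergman_monomial_in_space)

lemma bergman_ip_sum:
  assumes "\<And>i. i \<in> I \<Longrightarrow> f i \<in> bergman_space \<alpha>" "h \<in> bergman_space \<alpha>"
  shows "bergman_ip \<alpha> (\<lambda>z. \<Sum>i\<in>I. c i * f i z) h = (\<Sum>i\<in>I. c i * bergman_ip \<alpha> (f i) h)"
  using assms(1)
proof (induction I rule: infinite_finite_induct)
  case (insert i I)
  have "bergman_ip \<alpha> (\<lambda>z. c i * f i z + 1 * (\<Sum>i\<in>I. c i * f i z)) h
      = c i * bergman_ip \<alpha> (f i) h + 1 * bergman_ip \<alpha> (\<lambda>z. \<Sum>i\<in>I. c i * f i z) h"
    using insert assms(2) by (intro bergman_ip_lincomb bergman_space_sum) auto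
  then show ?case using insert by simp
qed (simp_all add: bergman_ip_def)

text \<open>
  Otherwise \<open>0\<close> would be at most an isolated zero of the sum.
\<close>

lemma power_series_zero_coeffs:
  fixes c :: "nat \<Rightarrow> complex"
  assumes sums: "\<And>z. z \<in> unit_disc \<Longrightarrow> (\<lambda>m. c m * z ^ m) sums 0"
  shows "c m = 0"
proof (rule ccontr)
  assume "c m \<noteq> 0"
  moreover have "c 0 = 0"
    using sums[of 0] powser_sums_zero_iff[of c 0] by simp
  ultimately have "m > 0" by (cases m) auto
  have "(\<lambda>m. c m * (z - 0) ^ m) sums 0" if "cmod (z - 0) < 1" for z
    using sums[of z] that by simp
  from powser_0_nonzero[OF zero_less_one this refl \<open>c m \<noteq> 0\<close> \<open>m > 0\<close>]
  obtain s where "0 < s" and s: "\<And>z::complex. z \<in> cball 0 s - {0} \<Longrightarrow> (0::complex) \<noteq> 0"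
    by blast
  with s[of "of_real s"] show False by simp
qed

lemma taylor_coeff_sums_unique:
  assumes "\<And>z. z \<in> unit_disc \<Longrightarrow> (\<lambda>m. b m * z ^ m) sums f z" "f holomorphic_on unit_disc"
  shows "taylor_coeff f m = b m"
proof -
  have "(\<lambda>m. (taylor_coeff f m - b m) * z ^ m) sums 0" if "z \<in> unit_disc" for z
    using sums_diff[OF taylor_coeff_sums[OF assms(2) that] assms(1)[OF that]]
    by (simp add: algebra_simps)
  then have "taylor_coeff f m - b m = 0"
    by (rule power_series_zero_coeffs)
  then show ?thesis by simp
qed

text \<open>
  Density of the polynomials, in the form of Parseval's identity.  Since \<open>taylor_poly f N\<close> is the
  orthogonal projection of \<open>f\<close> onto the polynomials of degree below \<open>N\<close>, the squared distance is
  \<open>\<parallel>f\<parallel>\<^sup>2\<close> minus a partial sum.  That the sum does not fall short of \<open>\<parallel>f\<parallel>\<^sup>2\<close> is where analyticity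
  enters: on a smaller disc equality holds with smaller moments, and the radius then tends to \<open>1\<close>.
\<close>

lemma taylor_poly_tendsto:
  assumes "\<alpha> > -1" "f \<in> bergman_space \<alpha>"
  shows "(\<lambda>N. ip_norm (bergman_ip \<alpha>) (\<lambda>z. f z - taylor_poly f N z)) \<longlonglongrightarrow> 0"
proof -
  let ?M = "bergman_measure \<alpha>"
  let ?c = "\<lambda>m. (cmod (taylor_coeff f m))\<^sup>2 * bergman_moment \<alpha> m"
  let ?I = "LINT z|?M. (cmod (f z))\<^sup>2"
  let ?d = "\<lambda>N. LINT z|?M. (cmod (f z - taylor_poly f N z))\<^sup>2"
  note hol = bergman_spaceD(1)[OF assms(2)]
  have c_nonneg: "0 \<le> ?c m" for m
    using bergman_moment_pos[OF assms(1), of m] by simp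
  have ip1: "bergman_ip \<alpha> (taylor_poly f N) f = of_real (\<Sum>m<N. ?c m)" for N
  proof -
    have "bergman_ip \<alpha> (taylor_poly f N) f = (\<Sum>m<N. taylor_coeff f m * bergman_ip \<alpha> (bergman_monomial m) f)"
      unfolding taylor_poly_def[abs_def] using assms by (intro bergman_ip_sum bergman_monomial_in_space)
    also have "\<dots> = (\<Sum>m<N. of_real (?c m))"
    proof (rule sum.cong)
      show "taylor_coeff f m * bergman_ip \<alpha> (bergman_monomial m) f = of_real (?c m)" for m
        unfolding cnj_bergman_ip[of \<alpha> f, symmetric] bergman_ip_monomial[OF assms]
        by (simp add: complex_norm_square del: of_real_power)
    qed simp
    finally show ?thesis by simp
  qed
  have ip2: "bergman_ip \<alpha> (taylor_poly f N) (taylor_poly f N) = of_real (\<Sum>m<N. ?c m)" for N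
  proof -
    let ?p = "taylor_poly f N"
    note p = taylor_poly_in_space[OF assms(1), of f N]
    have coeff: "taylor_coeff ?p m = (if m < N then taylor_coeff f m else 0)" for m
    proof (rule taylor_coeff_sums_unique[OF _ bergman_spaceD(1)[OF p]])
      fix z assume "z \<in> unit_disc"
      then have "?p z = (\<Sum>m<N. (if m < N then taylor_coeff f m else 0) * z ^ m)"
        unfolding taylor_poly_def by (intro sum.cong) (auto simp: bergman_monomial_def)
      then show "(\<lambda>m. (if m < N then taylor_coeff f m else 0) * z ^ m) sums ?p z"
        using sums_finite[of "{..<N}" "\<lambda>m. (if m < N then taylor_coeff f m else 0) * z ^ m"] by auto
    qed
    have "bergman_ip \<alpha> ?p ?p = (\<Sum>m<N. taylor_coeff f m * bergman_ip \<alpha> (bergman_monomial m) ?p)"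
      using assms p by (subst (1) taylor_poly_def[abs_def]) (intro bergman_ip_sum bergman_monomial_in_space)
    also have "\<dots> = (\<Sum>m<N. of_real (?c m))"
    proof (rule sum.cong)
      fix m assume "m \<in> {..<N}"
      then show "taylor_coeff f m * bergman_ip \<alpha> (bergman_monomial m) ?p = of_real (?c m)"
        unfolding cnj_bergman_ip[of \<alpha> ?p, symmetric] bergman_ip_monomial[OF assms(1) p] coeff
        by (simp add: complex_norm_square del: of_real_power)
    qed simp
    finally show ?thesis by (simp only: of_real_sum)
  qed
  have d: "?d N = ?I - (\<Sum>m<N. ?c m)" for N
  proof -
    note sp = assms(2) taylor_poly_in_space[OF assms(1), of f N]
    have "complex_of_real (?d N) = bergman_ip \<alpha> (\<lambda>z. 1 * f z + (-1) * taylor_poly f N z) (\<lambda>z. 1 * f z + (-1) * taylor_poly f N z)"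
      by (simp add: bergman_ip_self)
    also have "\<dots> = bergman_ip \<alpha> f f - bergman_ip \<alpha> (taylor_poly f N) f - cnj (bergman_ip \<alpha> (taylor_poly f N) f)
        + bergman_ip \<alpha> (taylor_poly f N) (taylor_poly f N)"
      by (subst bergman_ip_lincomb | subst bergman_ip_lincomb_right |
          (rule bergman_space_lincomb sp)+)+ (simp add: cnj_bergman_ip)
    also have "\<dots> = of_real (?I - (\<Sum>m<N. ?c m))"
      unfolding ip1 ip2 unfolding bergman_ip_self by simp
    finally show ?thesis by (simp only: of_real_eq_iff)
  qed
  have Bessel: "(\<Sum>m<N. ?c m) \<le> ?I" for N
  proof -
    have "0 \<le> ?d N" by simp
    then show ?thesis unfolding d by simp
  qed
  have summ: "summable ?c"
    by (rule summableI_nonneg_bounded[of _ ?I]) (use c_nonneg Bessel in auto)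
  have "?I \<le> suminf ?c"
  proof (rule LIMSEQ_le_const2)
    show "(\<lambda>j. LINT z|?M. indicator (ball 0 (real j / (real j + 1))) z * (cmod (f z))\<^sup>2) \<longlonglongrightarrow> ?I"
      by (intro integral_truncated_tendsto bergman_spaceD assms)
    have "(LINT z|?M. indicator (ball 0 (real j / (real j + 1))) z * (cmod (f z))\<^sup>2) \<le> suminf ?c" for j
      using truncated_Parseval[OF assms(1) hol, of "real j / (real j + 1)"] summ
        truncated_moment_bounds[OF assms(1), of "real j / (real j + 1)"]
      by (intro sums_le[OF _ _ summable_sums]) (auto intro!: mult_left_mono)
    then show "\<exists>N. \<forall>j\<ge>N. (LINT z|?M. indicator (ball 0 (real j / (real j + 1))) z * (cmod (f z))\<^sup>2) \<le> suminf ?c"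
      by blast
  qed
  moreover have "suminf ?c \<le> ?I"
    using Bessel by (intro suminf_le_const summ) auto
  ultimately have "?c sums ?I"
    using summ by (simp add: sums_iff)
  then have "(\<lambda>N. ?I - (\<Sum>m<N. ?c m)) \<longlonglongrightarrow> ?I - ?I"
    unfolding sums_def by (intro tendsto_intros)
  then have "(\<lambda>N. sqrt (?d N)) \<longlonglongrightarrow> sqrt 0"
    unfolding d by (intro tendsto_intros) simp
  then show ?thesis by (simp add: ip_norm_bergman)
qed

section \<open>Reproducing kernels of the derivatives\<close>

text \<open>
  For \<open>n = 0\<close> this is the reproducing kernel at \<open>w\<close>.  In general it is the \<open>n\<close>-th derivative of that
  kernel with respect to \<open>cnj w\<close>, hence the vector representing \<open>f \<mapsto> (deriv ^^ n) f w\<close>.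
\<close>

definition bergman_kernel :: "real \<Rightarrow> nat \<Rightarrow> complex \<Rightarrow> complex \<Rightarrow> complex" where
  "bergman_kernel \<alpha> n w z =
    (if z \<in> unit_disc
     then of_real (pochhammer (\<alpha> + 2) n) * z ^ n * (1 - cnj w * z) powr (- of_real (real n + \<alpha> + 2))
     else 0)"

lemma one_minus_notin_nonpos_Reals:
  fixes x :: complex
  assumes "cmod x < 1"
  shows "1 - x \<notin> \<real>\<^sub>\<le>\<^sub>0" and "0 < Re (1 - x)"
  using assms complex_Re_le_cmod[of x] by (auto simp: complex_nonpos_Reals_iff)

lemma norm_mult_less_one:
  fixes w z :: complex
  assumes "cmod w < 1" "cmod z \<le> 1"
  shows "cmod (w * z) < 1"
  using order.strict_trans1[OF mult_left_le[OF assms(2) norm_ge_zero] assms(1)]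
  by (simp add: norm_mult)

lemma one_minus_powr_sums:
  fixes x :: complex and s :: real
  assumes "cmod x < 1"
  shows "(\<lambda>k. of_real (pochhammer s k / fact k) * x ^ k) sums (1 - x) powr (- of_real s)"
proof -
  have "(- of_real s gchoose k) * (- x) ^ k = of_real (pochhammer s k / fact k) * x ^ k" for k
  proof -
    have sq: "(-1) ^ k * (-1) ^ k = (1 :: complex)"
      by (simp flip: power_mult_distrib)
    have "(- of_real s gchoose k) * (- x) ^ k
        = (-1) ^ k * (-1) ^ k * (pochhammer (of_real s) k / fact k * x ^ k)"
      unfolding gbinomial_pochhammer power_minus[of x k] minus_minus
      by (simp only: mult_ac times_divide_eq_right times_divide_eq_left)
    then show ?thesis
      unfolding sq by (simp add: pochhammer_of_real)
  qed
  then show ?thesis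
    using gen_binomial_complex[of "- x" "- of_real s"] assms by simp
qed

lemma summable_pochhammer:
  fixes s r :: real
  assumes "0 < s" "0 \<le> r" "r < 1"
  shows "summable (\<lambda>k. pochhammer s k / fact k * r ^ k)"
proof -
  have "summable (\<lambda>k. of_real (pochhammer s k / fact k) * complex_of_real r ^ k)"
    using assms by (intro sums_summable[OF one_minus_powr_sums]) simp
  then have "summable (\<lambda>k. complex_of_real (pochhammer s k / fact k * r ^ k))"
    by simp
  then show ?thesis by (simp only: summable_of_real_iff)
qed

text \<open>
  The power is singular at most at \<open>1 / cnj w\<close>, outside the closed disc, so the kernel is bounded.
\<close>

lemma bergman_kernel_in_space:
  assumes "\<alpha> > -1" "w \<in> unit_disc"
  shows "bergman_kernel \<alpha> n w \<in> bergman_space \<alpha>"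
proof -
  let ?k = "\<lambda>z. of_real (pochhammer (\<alpha> + 2) n) * z ^ n * (1 - cnj w * z) powr (- of_real (real n + \<alpha> + 2))"
  have pos: "0 < Re (1 - cnj w * z)" "1 - cnj w * z \<notin> \<real>\<^sub>\<le>\<^sub>0" if "cmod z \<le> 1" for z
    using assms(2) that norm_mult_less_one[of "cnj w" z] one_minus_notin_nonpos_Reals[of "cnj w * z"]
    by auto
  have "continuous_on (cball 0 1) (\<lambda>z. (1 - cnj w * z) powr (- of_real (real n + \<alpha> + 2)))"
  proof (rule continuous_on_powr_complex)
    show "cball 0 1 \<subseteq> {z. 0 \<le> Re (1 - cnj w * z) \<or> Im (1 - cnj w * z) \<noteq> 0}"
      using pos(1) by (intro subsetI CollectI disjI1 less_imp_le) auto
    show "0 < Re (- complex_of_real (real n + \<alpha> + 2))"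
      if "z \<in> cball 0 1" "1 - cnj w * z = 0" for z
      using pos(1)[of z] that by simp
  qed (intro continuous_intros)+
  then have "continuous_on (cball 0 1) ?k"
    by (intro continuous_on_mult continuous_on_const continuous_on_power continuous_on_id)
  then have "bounded (?k ` cball 0 1)"
    by (intro compact_imp_bounded compact_continuous_image) auto
  then obtain B where "\<forall>y \<in> ?k ` cball 0 1. cmod y \<le> B"
    unfolding bounded_iff by blast
  then have B: "cmod (?k z) \<le> B" if "z \<in> unit_disc" for z
    using that by (elim bspec) (intro imageI, simp)
  show ?thesis
  proof (rule bounded_holomorphic_in_bergman_space[OF assms(1)])
    show "bergman_kernel \<alpha> n w holomorphic_on unit_disc"
    proof (rule holomorphic_transform)
      show "?k holomorphic_on unit_disc"
        using pos by (intro holomorphic_intros) auto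
    qed (auto simp: bergman_kernel_def)
    show "cmod (bergman_kernel \<alpha> n w z) \<le> B" if "z \<in> unit_disc" for z
      using that B[OF that] by (simp add: bergman_kernel_def)
  qed (simp add: bergman_kernel_def)
qed

text \<open>
  Both sides are power series in \<open>w\<close>.  The binomial series expands the kernel as \<open>z ^ n\<close> times a
  power series in \<open>cnj w * z\<close>, whose coefficient of degree \<open>k\<close> times the moment of order \<open>n + k\<close>
  is \<open>fact (n + k) / fact k\<close>, the factor produced by differentiating \<open>w ^ (n + k)\<close> \<open>n\<close> times.
\<close>

lemma bergman_ip_kernel:
  assumes "\<alpha> > -1" "w \<in> unit_disc" "f \<in> bergman_space \<alpha>"
  shows "bergman_ip \<alpha> f (bergman_kernel \<alpha> n w) = (deriv ^^ n) f w"
proof -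
  let ?M = "bergman_measure \<alpha>"
  define s where "s = real n + \<alpha> + 2"
  define P where "P = pochhammer (\<alpha> + 2) n"
  define b where "b k = of_real (P * (pochhammer s k / fact k)) * cnj w ^ k" for k
  define g where "g z = of_real P * (1 - cnj w * z) powr (- of_real s)" for z
  have s: "s > 0" using assms(1) by (simp add: s_def)
  have hol: "f holomorphic_on unit_disc" using assms(3) by (rule bergman_spaceD)
  have mono: "integrable ?M (\<lambda>z. cnj (f z) * z ^ m)"
    "(LINT z|?M. cnj (f z) * z ^ m) = cnj (taylor_coeff f m) * of_real (bergman_moment \<alpha> m)" for m
  proof -
    have eq: "bergman_monomial m z * cnj (f z) = cnj (f z) * z ^ m" if "z \<in> unit_disc" for z
      using that by (simp add: bergman_monomial_def)
    show "integrable ?M (\<lambda>z. cnj (f z) * z ^ m)"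
      using integrable_bergman_space_mult_cnj[OF bergman_monomial_in_space[OF assms(1)] assms(3), of m]
      by (rule Bochner_Integration.integrable_cong[THEN iffD1, rotated -1]) (auto simp: eq)
    have "(LINT z|?M. cnj (f z) * z ^ m) = bergman_ip \<alpha> (bergman_monomial m) f"
      unfolding bergman_ip_def by (rule Bochner_Integration.integral_cong) (auto simp: eq)
    also have "\<dots> = cnj (taylor_coeff f m * of_real (bergman_moment \<alpha> m))"
      by (simp add: bergman_ip_monomial[OF assms(1,3), symmetric] cnj_bergman_ip del: complex_cnj_mult)
    finally show "(LINT z|?M. cnj (f z) * z ^ m) = cnj (taylor_coeff f m) * of_real (bergman_moment \<alpha> m)"
      by simp
  qed
  have "(\<lambda>k. b k * (LINT z|?M. cnj (f z) * z ^ n * z ^ k)) sums (LINT z|?M. cnj (f z) * z ^ n * g z)"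
  proof (rule integral_mult_power_series[where r = 1])
    have "cmod (b k) * 1 ^ k = P * (pochhammer s k / fact k * cmod w ^ k)" for k
      using pochhammer_nonneg[OF s, of k] pochhammer_nonneg[of "\<alpha> + 2" n] assms(1)
      by (simp add: b_def P_def norm_mult norm_divide norm_power)
    moreover have "summable (\<lambda>k. P * (pochhammer s k / fact k * cmod w ^ k))"
      using assms(2) by (intro summable_mult summable_pochhammer[OF s]) auto
    ultimately show "summable (\<lambda>k. cmod (b k) * 1 ^ k)"
      by (simp only:)
    show "(\<lambda>k. b k * z ^ k) sums g z" if "z \<in> unit_disc" for z
    proof -
      have "cmod (cnj w * z) < 1"
        using assms(2) that by (intro norm_mult_less_one) auto
      from sums_mult[OF one_minus_powr_sums[OF this, of s], of "of_real P"] show ?thesis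
        by (simp add: b_def g_def power_mult_distrib mult_ac)
    qed
  qed (use mono(1)[of n] in auto)
  moreover have "b k * (LINT z|?M. cnj (f z) * z ^ n * z ^ k)
      = cnj ((deriv ^^ k) ((deriv ^^ n) f) 0 / fact k * w ^ k)" for k
  proof -
    have "P * pochhammer s k = pochhammer (\<alpha> + 2) (n + k)"
      using pochhammer_product'[of "\<alpha> + 2" n k] by (simp add: P_def s_def algebra_simps)
    then have "P * pochhammer s k * bergman_moment \<alpha> (n + k) = fact (n + k)"
      using pochhammer_pos[of "\<alpha> + 2" "n + k"] assms(1) by (simp add: bergman_moment_def)
    then have "complex_of_real (P * (pochhammer s k / fact k)) * of_real (bergman_moment \<alpha> (n + k))
        = fact (n + k) / fact k"
      by (simp flip: of_real_mult)
    moreover have "(LINT z|?M. cnj (f z) * z ^ n * z ^ k)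
        = cnj (taylor_coeff f (n + k)) * of_real (bergman_moment \<alpha> (n + k))"
      using mono(2)[of "n + k"] by (simp add: power_add mult.assoc)
    ultimately have "b k * (LINT z|?M. cnj (f z) * z ^ n * z ^ k)
        = fact (n + k) / fact k * cnj w ^ k * cnj (taylor_coeff f (n + k))"
      by (simp only: b_def mult_ac)
    also have "\<dots> = cnj ((deriv ^^ (k + n)) f 0 / fact k * w ^ k)"
      by (simp add: taylor_coeff_def add.commute)
    finally show ?thesis by (simp add: funpow_add)
  qed
  moreover have "(\<lambda>k. cnj ((deriv ^^ k) ((deriv ^^ n) f) 0 / fact k * w ^ k)) sums cnj ((deriv ^^ n) f w)"
  proof -
    have "(deriv ^^ n) f holomorphic_on unit_disc"
      using hol by (intro holomorphic_higher_deriv) auto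
    from holomorphic_power_series[OF this assms(2)] show ?thesis
      by (subst sums_cnj) simp
  qed
  ultimately have "(LINT z|?M. cnj (f z) * z ^ n * g z) = cnj ((deriv ^^ n) f w)"
    using sums_unique2 by fastforce
  moreover have "(LINT z|?M. cnj (f z) * z ^ n * g z) = bergman_ip \<alpha> (bergman_kernel \<alpha> n w) f"
    unfolding bergman_ip_def
    by (rule Bochner_Integration.integral_cong) (auto simp: bergman_kernel_def g_def P_def s_def)
  ultimately show ?thesis
    by (metis cnj_bergman_ip complex_cnj_cnj)
qed

text \<open>
  Point evaluations are inner products with kernels.  This makes an adjoint unique once a
  candidate is known.
\<close>

lemma bergman_space_eqI:
  assumes "\<alpha> > -1" "g \<in> bergman_space \<alpha>" "h \<in> bergman_space \<alpha>"
    and "\<And>f. f \<in> bergman_space \<alpha> \<Longrightarrow> bergman_ip \<alpha> f g = bergman_ip \<alpha> f h"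
  shows "g = h"
proof
  fix z
  show "g z = h z"
  proof (cases "z \<in> unit_disc")
    case True
    have "bergman_ip \<alpha> g (bergman_kernel \<alpha> 0 z) = bergman_ip \<alpha> h (bergman_kernel \<alpha> 0 z)"
      using assms(4)[OF bergman_kernel_in_space[OF assms(1) True]] by (metis cnj_bergman_ip)
    then show ?thesis
      using bergman_ip_kernel[OF assms(1) True assms(2), of 0] bergman_ip_kernel[OF assms(1) True assms(3), of 0]
      by simp
  qed (use bergman_spaceD(2)[OF assms(2)] bergman_spaceD(2)[OF assms(3)] in simp)
qed

text \<open>
  A bounded functional may be applied to Taylor series term by term.  On the kernels this gives a
  power series in \<open>cnj w\<close> whose coefficients are nonzero multiples of the values at the monomials;
  if it vanishes identically, then so do those values, and the functional.
\<close>

lemma bergman_kernels_total: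
  fixes L :: "(complex \<Rightarrow> complex) \<Rightarrow> complex"
  assumes "\<alpha> > -1"
    and lin: "\<And>f g a b. f \<in> bergman_space \<alpha> \<Longrightarrow> g \<in> bergman_space \<alpha> \<Longrightarrow>
      L (\<lambda>z. a * f z + b * g z) = a * L f + b * L g"
    and bd: "\<And>f. f \<in> bergman_space \<alpha> \<Longrightarrow> cmod (L f) \<le> K * ip_norm (bergman_ip \<alpha>) f"
    and ker: "\<And>w. w \<in> unit_disc \<Longrightarrow> L (bergman_kernel \<alpha> 0 w) = 0"
    and f: "f \<in> bergman_space \<alpha>"
  shows "L f = 0"
proof -
  have L0: "L (\<lambda>z. 0) = 0"
    using lin[OF bergman_space_zero bergman_space_zero, of 0 0] by simp
  have L_poly: "L (taylor_poly f N) = (\<Sum>m<N. taylor_coeff f m * L (bergman_monomial m))" for f N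
  proof (induction N)
    case (Suc N)
    have "L (\<lambda>z. 1 * taylor_poly f N z + taylor_coeff f N * bergman_monomial N z)
        = 1 * L (taylor_poly f N) + taylor_coeff f N * L (bergman_monomial N)"
      using assms(1) by (intro lin taylor_poly_in_space bergman_monomial_in_space)
    with Suc show ?case by (simp add: taylor_poly_def[abs_def])
  qed (simp add: taylor_poly_def[abs_def] L0)
  have expand: "(\<lambda>m. taylor_coeff f m * L (bergman_monomial m)) sums L f"
    if f: "f \<in> bergman_space \<alpha>" for f
  proof -
    have "(\<lambda>N. L (taylor_poly f N) - L f) \<longlonglongrightarrow> 0"
    proof (rule Lim_null_comparison)
      have "cmod (L (taylor_poly f N) - L f) \<le> K * ip_norm (bergman_ip \<alpha>) (\<lambda>z. f z - taylor_poly f N z)" for N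
      proof -
        note sp = f taylor_poly_in_space[OF assms(1), of f N]
        have "cmod (L (taylor_poly f N) - L f) = cmod (L (\<lambda>z. 1 * f z + (-1) * taylor_poly f N z))"
          unfolding lin[OF sp] by (simp add: norm_minus_commute)
        also have "\<dots> \<le> K * ip_norm (bergman_ip \<alpha>) (\<lambda>z. 1 * f z + (-1) * taylor_poly f N z)"
          by (intro bd bergman_space_lincomb sp)
        finally show ?thesis by simp
      qed
      then show "\<forall>\<^sub>F N in sequentially. cmod (L (taylor_poly f N) - L f)
          \<le> K * ip_norm (bergman_ip \<alpha>) (\<lambda>z. f z - taylor_poly f N z)"
        by simp
      show "(\<lambda>N. K * ip_norm (bergman_ip \<alpha>) (\<lambda>z. f z - taylor_poly f N z)) \<longlonglongrightarrow> 0"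
        using tendsto_mult_right_zero[OF taylor_poly_tendsto[OF assms(1) f]] by simp
    qed
    then show ?thesis
      unfolding sums_def L_poly[symmetric] by (rule LIM_zero_cancel)
  qed
  have coeff: "taylor_coeff (bergman_kernel \<alpha> 0 w) m = of_real (pochhammer (\<alpha> + 2) m / fact m) * cnj w ^ m"
    if "w \<in> unit_disc" for w m
  proof (rule taylor_coeff_sums_unique)
    fix z assume "z \<in> unit_disc"
    then have "cmod (cnj w * z) < 1"
      using that by (intro norm_mult_less_one) auto
    from one_minus_powr_sums[OF this, of "\<alpha> + 2"] \<open>z \<in> unit_disc\<close>
    show "(\<lambda>m. of_real (pochhammer (\<alpha> + 2) m / fact m) * cnj w ^ m * z ^ m) sums bergman_kernel \<alpha> 0 w z"
      by (simp add: bergman_kernel_def power_mult_distrib mult_ac)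
  qed (rule bergman_spaceD(1)[OF bergman_kernel_in_space[OF assms(1) that]])
  have "of_real (pochhammer (\<alpha> + 2) m / fact m) * L (bergman_monomial m) = 0" for m
  proof (rule power_series_zero_coeffs)
    fix v :: complex assume "v \<in> unit_disc"
    then have "cnj v \<in> unit_disc" by simp
    from expand[OF bergman_kernel_in_space[OF assms(1) this, of 0]] ker[OF this] coeff[OF this]
    show "(\<lambda>m. of_real (pochhammer (\<alpha> + 2) m / fact m) * L (bergman_monomial m) * v ^ m) sums 0"
      by (simp add: mult_ac)
  qed
  moreover have "pochhammer (\<alpha> + 2) m \<noteq> 0" for m
    using pochhammer_pos[of "\<alpha> + 2" m] assms(1) by simp
  ultimately have "L (bergman_monomial m) = 0" for m
    by simp
  with expand[OF f] show ?thesis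
    using sums_unique2[OF _ sums_zero] by simp
qed

section \<open>Complex symmetry as a functional equation\<close>

text \<open>
  The reflection \<open>z \<mapsto> cnj (\<eta> * z)\<close> preserves the measure, and conjugating both the argument and
  the value of an analytic function gives an analytic function.
\<close>

lemma conj_op_in_bergman_space:
  assumes "cmod \<eta> = 1" "f \<in> bergman_space \<alpha>"
  shows "conj_op \<mu> \<eta> f \<in> bergman_space \<alpha>"
proof -
  have pres: "preserves_area (\<lambda>z. cnj (\<eta> * z))"
    by (rule preserves_area_comp[OF preserves_area_cnj preserves_area_rotation[OF assms(1)]])
  have [measurable]: "f \<in> borel_measurable (bergman_measure \<alpha>)"
    using assms(2) by (rule bergman_spaceD)
  have "integrable (bergman_measure \<alpha>) (\<lambda>z. (cmod (f (cnj (\<eta> * z))))\<^sup>2)"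
    using integral_bergman_measure_invariant(2)[OF pres, of "\<lambda>z. (cmod (f z))\<^sup>2" \<alpha>]
      bergman_spaceD(3)[OF assms(2)] assms(1) by (simp add: norm_mult)
  then have "integrable (bergman_measure \<alpha>) (\<lambda>z. (cmod (conj_op \<mu> \<eta> f z))\<^sup>2)"
    by (simp add: conj_op_def norm_mult power_mult_distrib)
  moreover have "conj_op \<mu> \<eta> f holomorphic_on unit_disc"
  proof -
    have 1: "cnj \<circ> f \<circ> cnj holomorphic_on unit_disc"
    proof (rule holomorphic_on_compose_cnj_cnj)
      have "cnj ` unit_disc \<subseteq> unit_disc" by auto
      then show "f holomorphic_on cnj ` unit_disc"
        by (rule holomorphic_on_subset[OF bergman_spaceD(1)[OF assms(2)]])
    qed simp
    have 2: "(\<lambda>z. \<eta> * z) holomorphic_on unit_disc"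
      by (intro holomorphic_intros)
    have 3: "(\<lambda>z. \<eta> * z) ` unit_disc \<subseteq> unit_disc"
      using assms(1) by (auto simp: norm_mult)
    have "(cnj \<circ> f \<circ> cnj) \<circ> (\<lambda>z. \<eta> * z) holomorphic_on unit_disc"
      by (rule holomorphic_on_compose_gen[OF 2 1 3])
    then have "(\<lambda>z. \<mu> * ((cnj \<circ> f \<circ> cnj) \<circ> (\<lambda>z. \<eta> * z)) z) holomorphic_on unit_disc"
      by (intro holomorphic_intros)
    then show ?thesis by (simp add: conj_op_def[abs_def])
  qed
  moreover have "conj_op \<mu> \<eta> f z = 0" if "z \<notin> unit_disc" for z
    using bergman_spaceD(2)[OF assms(2), of "cnj (\<eta> * z)"] that assms(1)
    by (simp add: conj_op_def norm_mult)
  ultimately show ?thesis by (simp add: bergman_space_def)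
qed

lemma conj_op_involutive:
  assumes "cmod \<mu> = 1" "cmod \<eta> = 1"
  shows "conj_op \<mu> \<eta> (conj_op \<mu> \<eta> f) = f"
proof
  fix z
  have "\<mu> * cnj \<mu> = 1" "cnj \<eta> * \<eta> = 1"
    using assms complex_norm_square[of \<mu>] complex_norm_square[of \<eta>] by (auto simp: mult.commute)
  then have "cnj \<eta> * (\<eta> * z) = z" "\<mu> * (cnj \<mu> * f z) = f z"
    by (simp_all flip: mult.assoc)
  then show "conj_op \<mu> \<eta> (conj_op \<mu> \<eta> f) z = f z"
    by (simp only: conj_op_def complex_cnj_mult complex_cnj_cnj)
qed

lemma bergman_ip_conj_op:
  assumes "cmod \<mu> = 1" "cmod \<eta> = 1" "f \<in> bergman_space \<alpha>" "g \<in> bergman_space \<alpha>"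
  shows "bergman_ip \<alpha> (conj_op \<mu> \<eta> f) (conj_op \<mu> \<eta> g) = bergman_ip \<alpha> g f"
proof -
  have pres: "preserves_area (\<lambda>z. cnj (\<eta> * z))"
    by (rule preserves_area_comp[OF preserves_area_cnj preserves_area_rotation[OF assms(2)]])
  have \<mu>: "\<mu> * cnj \<mu> = 1"
    using assms(1) complex_norm_square[of \<mu>] by simp
  have "conj_op \<mu> \<eta> f z * cnj (conj_op \<mu> \<eta> g z) = g (cnj (\<eta> * z)) * cnj (f (cnj (\<eta> * z)))" for z
  proof -
    have "conj_op \<mu> \<eta> f z * cnj (conj_op \<mu> \<eta> g z)
        = (\<mu> * cnj \<mu>) * (g (cnj (\<eta> * z)) * cnj (f (cnj (\<eta> * z))))"
      by (simp add: conj_op_def mult_ac)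
    then show ?thesis unfolding \<mu> by simp
  qed
  then have "bergman_ip \<alpha> (conj_op \<mu> \<eta> f) (conj_op \<mu> \<eta> g)
      = (LINT z|bergman_measure \<alpha>. g (cnj (\<eta> * z)) * cnj (f (cnj (\<eta> * z))))"
    by (simp add: bergman_ip_def)
  also have "\<dots> = bergman_ip \<alpha> g f"
    unfolding bergman_ip_def
    by (rule integral_bergman_measure_invariant(1)[OF pres, of "\<lambda>z. g z * cnj (f z)"])
      (use assms in \<open>auto simp: norm_mult intro: borel_measurable_integrable integrable_bergman_space_mult_cnj\<close>)
  finally show ?thesis .
qed

lemma conjugation_on_conj_op:
  assumes "cmod \<mu> = 1" "cmod \<eta> = 1"
  shows "conjugation_on (bergman_space \<alpha>) (bergman_ip \<alpha>) (conj_op \<mu> \<eta>)"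
  unfolding conjugation_on_def
  using assms
  by (auto simp: conj_op_in_bergman_space conj_op_involutive bergman_ip_conj_op)
    (auto simp: conj_op_def fun_eq_iff algebra_simps)

text \<open>
  The derivative of the kernel at \<open>v\<close>, evaluated at \<open>p\<close>, is the inner product of the kernel at \<open>v\<close>
  with the \<open>n\<close>-th derivative kernel at \<open>p\<close>; by symmetry it is also a conjugated value of the latter,
  which is explicit.
\<close>

lemma higher_deriv_bergman_kernel:
  assumes "\<alpha> > -1" "v \<in> unit_disc" "p \<in> unit_disc"
  shows "(deriv ^^ n) (bergman_kernel \<alpha> 0 v) p = of_real (pochhammer (\<alpha> + 2) n) * cnj v ^ n
    * (1 - cnj v * p) powr (- of_real (real n + \<alpha> + 2))"
proof -
  have "(deriv ^^ n) (bergman_kernel \<alpha> 0 v) p = bergman_ip \<alpha> (bergman_kernel \<alpha> 0 v) (bergman_kernel \<alpha> n p)"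
    using assms by (simp add: bergman_ip_kernel bergman_kernel_in_space)
  also have "\<dots> = cnj (bergman_ip \<alpha> (bergman_kernel \<alpha> n p) (bergman_kernel \<alpha> 0 v))"
    by (rule cnj_bergman_ip[symmetric])
  also have "\<dots> = cnj (bergman_kernel \<alpha> n p v)"
    using assms by (simp add: bergman_ip_kernel bergman_kernel_in_space)
  also have "\<dots> = of_real (pochhammer (\<alpha> + 2) n) * cnj v ^ n
      * cnj ((1 - cnj p * v) powr (- of_real (real n + \<alpha> + 2)))"
    using assms(2) by (simp add: bergman_kernel_def)
  also have "cnj ((1 - cnj p * v) powr (- of_real (real n + \<alpha> + 2)))
      = (1 - cnj v * p) powr (- of_real (real n + \<alpha> + 2))"
  proof -
    have "0 < Re (1 - cnj p * v)"
      using assms by (intro one_minus_notin_nonpos_Reals norm_mult_less_one) auto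
    then show ?thesis
      by (subst cnj_powr) (auto simp: mult.commute)
  qed
  finally show ?thesis .
qed

lemma conj_op_bergman_kernel:
  assumes "cmod \<eta> = 1" "w \<in> unit_disc" "z \<in> unit_disc"
  shows "conj_op \<mu> \<eta> (bergman_kernel \<alpha> n w) z = \<mu> * (of_real (pochhammer (\<alpha> + 2) n) * (\<eta> * z) ^ n
    * (1 - \<eta> * z * w) powr (- of_real (real n + \<alpha> + 2)))"
proof -
  have "cnj (\<eta> * z) \<in> unit_disc" using assms by (simp add: norm_mult)
  moreover have "0 < Re (1 - cnj w * cnj (\<eta> * z))"
    using assms by (intro one_minus_notin_nonpos_Reals norm_mult_less_one) (auto simp: norm_mult)
  then have "cnj ((1 - cnj w * cnj (\<eta> * z)) powr (- of_real (real n + \<alpha> + 2)))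
      = (1 - \<eta> * z * w) powr (- of_real (real n + \<alpha> + 2))"
    by (subst cnj_powr) (auto simp: mult_ac)
  ultimately show ?thesis
    by (simp add: conj_op_def bergman_kernel_def)
qed

lemma bergman_space_scale: "f \<in> bergman_space \<alpha> \<Longrightarrow> (\<lambda>z. c * f z) \<in> bergman_space \<alpha>"
  using bergman_space_lincomb[of f \<alpha> f c 0] by simp

lemma bergman_ip_scale_right:
  "f \<in> bergman_space \<alpha> \<Longrightarrow> g \<in> bergman_space \<alpha> \<Longrightarrow>
    bergman_ip \<alpha> f (\<lambda>z. c * g z) = cnj c * bergman_ip \<alpha> f g"
  using bergman_ip_lincomb_right[of g \<alpha> g f c 0] by simp

text \<open>
  The image of the kernel at \<open>w\<close> under the adjoint of the operator:
  \<open>\<psi> w * (deriv ^^ n) f (\<phi> w)\<close> is the inner product of \<open>f\<close> with it.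
\<close>

definition adjoint_kernel :: "real \<Rightarrow> nat \<Rightarrow> (complex \<Rightarrow> complex) \<Rightarrow> (complex \<Rightarrow> complex) \<Rightarrow> complex
    \<Rightarrow> complex \<Rightarrow> complex" where
  "adjoint_kernel \<alpha> n \<psi> \<phi> w = (\<lambda>z. cnj (\<psi> w) * bergman_kernel \<alpha> n (\<phi> w) z)"

context
  fixes \<alpha> :: real and n :: nat and \<mu> \<eta> :: complex and \<phi> \<psi> :: "complex \<Rightarrow> complex"
  assumes \<alpha>: "\<alpha> > -1" and \<mu>: "cmod \<mu> = 1" and \<eta>: "cmod \<eta> = 1"
    and \<phi>: "\<And>z. z \<in> unit_disc \<Longrightarrow> \<phi> z \<in> unit_disc"
    and bounded: "bounded_operator_on (bergman_space \<alpha>) (bergman_ip \<alpha>) (wcomp_diff n \<psi> \<phi>)"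
begin

abbreviation (input) "\<D> \<equiv> wcomp_diff n \<psi> \<phi>"
abbreviation (input) "\<C> \<equiv> conj_op \<mu> \<eta>"

lemma wcomp_diff_in_space: "f \<in> bergman_space \<alpha> \<Longrightarrow> \<D> f \<in> bergman_space \<alpha>"
  using bounded by (simp add: bounded_operator_on_def)

lemma wcomp_diff_lincomb:
  "f \<in> bergman_space \<alpha> \<Longrightarrow> g \<in> bergman_space \<alpha> \<Longrightarrow>
    \<D> (\<lambda>z. a * f z + b * g z) = (\<lambda>z. a * \<D> f z + b * \<D> g z)"
  using bounded unfolding bounded_operator_on_def by blast

lemma adjoint_kernel_in_space: "w \<in> unit_disc \<Longrightarrow> adjoint_kernel \<alpha> n \<psi> \<phi> w \<in> bergman_space \<alpha>"
  unfolding adjoint_kernel_def by (intro bergman_space_scale bergman_kernel_in_space \<alpha> \<phi>)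

lemma bergman_ip_adjoint_kernel:
  assumes "w \<in> unit_disc" "f \<in> bergman_space \<alpha>"
  shows "bergman_ip \<alpha> f (adjoint_kernel \<alpha> n \<psi> \<phi> w) = \<D> f w"
    and "bergman_ip \<alpha> (\<D> f) (bergman_kernel \<alpha> 0 w) = \<D> f w"
  using assms \<alpha> \<phi>[OF assms(1)] wcomp_diff_in_space[OF assms(2)]
  by (simp_all add: adjoint_kernel_def bergman_ip_scale_right bergman_kernel_in_space bergman_ip_kernel
      wcomp_diff_def)

text \<open>
  The adjoint is a definite description, so the existence of \<open>h\<close> is taken as a premise; candidates
  for it are always available below, in place of the Riesz representation theorem.
\<close>

lemma adjoint_on_eqI:
  assumes "h \<in> bergman_space \<alpha>" "\<And>f. f \<in> bergman_space \<alpha> \<Longrightarrow> bergman_ip \<alpha> (\<D> f) g = bergman_ip \<alpha> f h"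
  shows "adjoint_on (bergman_space \<alpha>) (bergman_ip \<alpha>) \<D> g = h"
  unfolding adjoint_on_def
proof (rule the_equality)
  show "k = h" if "k \<in> bergman_space \<alpha> \<and> (\<forall>f\<in>bergman_space \<alpha>. bergman_ip \<alpha> (\<D> f) g = bergman_ip \<alpha> f k)" for k
    using that assms by (intro bergman_space_eqI[OF \<alpha>]) auto
qed (use assms in blast)

lemma adjoint_on_kernel:
  assumes "w \<in> unit_disc"
  shows "adjoint_on (bergman_space \<alpha>) (bergman_ip \<alpha>) \<D> (bergman_kernel \<alpha> 0 w) = adjoint_kernel \<alpha> n \<psi> \<phi> w"
  using assms by (intro adjoint_on_eqI adjoint_kernel_in_space) (simp_all add: bergman_ip_adjoint_kernel)

lemma wcomp_diff_conj_kernel: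
  assumes "w \<in> unit_disc" "z \<in> unit_disc"
  shows "\<D> (\<C> (bergman_kernel \<alpha> 0 w)) z = \<mu> * of_real (pochhammer (\<alpha> + 2) n) * \<eta> ^ n
    * (\<psi> z * w ^ n * (1 - \<eta> * w * \<phi> z) powr (- of_real (real n + \<alpha> + 2)))"
proof -
  let ?v = "cnj (\<eta> * w)"
  have v: "?v \<in> unit_disc" using assms(1) \<eta> by (simp add: norm_mult)
  have k: "bergman_kernel \<alpha> 0 ?v \<in> bergman_space \<alpha>"
    by (rule bergman_kernel_in_space[OF \<alpha> v])
  have "\<C> (bergman_kernel \<alpha> 0 w) = (\<lambda>z. \<mu> * bergman_kernel \<alpha> 0 ?v z + 0 * bergman_kernel \<alpha> 0 ?v z)"
  proof
    fix z
    show "\<C> (bergman_kernel \<alpha> 0 w) z = \<mu> * bergman_kernel \<alpha> 0 ?v z + 0 * bergman_kernel \<alpha> 0 ?v z"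
    proof (cases "z \<in> unit_disc")
      case True
      then show ?thesis
        unfolding conj_op_bergman_kernel[OF \<eta> assms(1) True] by (simp add: bergman_kernel_def mult_ac)
    next
      case False
      then have "\<C> (bergman_kernel \<alpha> 0 w) z = 0"
        by (intro bergman_spaceD(2)[OF conj_op_in_bergman_space[OF \<eta> bergman_kernel_in_space[OF \<alpha> assms(1)]]])
      with False show ?thesis by (simp add: bergman_kernel_def)
    qed
  qed
  then have "\<D> (\<C> (bergman_kernel \<alpha> 0 w)) = (\<lambda>z. \<mu> * \<D> (bergman_kernel \<alpha> 0 ?v) z + 0 * \<D> (bergman_kernel \<alpha> 0 ?v) z)"
    using wcomp_diff_lincomb[OF k k, of \<mu> 0] by (simp only:)
  then have "\<D> (\<C> (bergman_kernel \<alpha> 0 w)) z = \<mu> * (\<psi> z * (deriv ^^ n) (bergman_kernel \<alpha> 0 ?v) (\<phi> z))"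
    using assms(2) by (simp add: wcomp_diff_def)
  then show ?thesis
    unfolding higher_deriv_bergman_kernel[OF \<alpha> v \<phi>[OF assms(2)]]
    by (simp add: power_mult_distrib mult_ac)
qed

lemma conj_adjoint_kernel:
  assumes "w \<in> unit_disc" "z \<in> unit_disc"
  shows "\<C> (adjoint_kernel \<alpha> n \<psi> \<phi> w) z = \<mu> * of_real (pochhammer (\<alpha> + 2) n) * \<eta> ^ n
    * (\<psi> w * z ^ n * (1 - \<eta> * z * \<phi> w) powr (- of_real (real n + \<alpha> + 2)))"
proof -
  have "\<C> (adjoint_kernel \<alpha> n \<psi> \<phi> w) z = \<psi> w * \<C> (bergman_kernel \<alpha> n (\<phi> w)) z"
    by (simp add: conj_op_def adjoint_kernel_def)
  then show ?thesis
    unfolding conj_op_bergman_kernel[OF \<eta> \<phi>[OF assms(1)] assms(2)]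
    by (simp add: power_mult_distrib mult_ac)
qed

text \<open>
  Complex symmetry says that the bilinear form \<open>(f, u) \<mapsto> bergman_ip \<alpha> (\<D> f) (\<C> u)\<close> is
  symmetric.  With \<open>u\<close> fixed, the two sides differ by a bounded functional of \<open>g\<close>, which vanishes on
  the kernels by assumption and hence everywhere.
\<close>

lemma wcomp_diff_conj_symmetric:
  assumes on_kernels: "\<And>w. w \<in> unit_disc \<Longrightarrow> \<D> (\<C> (bergman_kernel \<alpha> 0 w)) = \<C> (adjoint_kernel \<alpha> n \<psi> \<phi> w)"
    and u: "u \<in> bergman_space \<alpha>" and g: "g \<in> bergman_space \<alpha>"
  shows "bergman_ip \<alpha> (\<C> u) (\<D> (\<C> g)) = bergman_ip \<alpha> g (\<D> u)"
proof -
  define L where "L g = bergman_ip \<alpha> (\<C> u) (\<D> (\<C> g)) - bergman_ip \<alpha> g (\<D> u)" for g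
  note conj_space = conj_op_in_bergman_space[OF \<eta>, where \<mu> = \<mu>]
  obtain M where M: "\<And>f. f \<in> bergman_space \<alpha> \<Longrightarrow> ip_norm (bergman_ip \<alpha>) (\<D> f) \<le> M * ip_norm (bergman_ip \<alpha>) f"
    using bounded unfolding bounded_operator_on_def by blast
  have norm_conj: "ip_norm (bergman_ip \<alpha>) (\<C> f) = ip_norm (bergman_ip \<alpha>) f" if "f \<in> bergman_space \<alpha>" for f
    by (simp add: ip_norm_def bergman_ip_conj_op[OF \<mu> \<eta> that that])
  have "L g = 0"
  proof (rule bergman_kernels_total[OF \<alpha>, of L])
    fix f h a b assume fh: "f \<in> bergman_space \<alpha>" "h \<in> bergman_space \<alpha>"
    have "\<C> (\<lambda>z. a * f z + b * h z) = (\<lambda>z. cnj a * \<C> f z + cnj b * \<C> h z)"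
      by (simp add: conj_op_def fun_eq_iff algebra_simps)
    then have "\<D> (\<C> (\<lambda>z. a * f z + b * h z)) = (\<lambda>z. cnj a * \<D> (\<C> f) z + cnj b * \<D> (\<C> h) z)"
      using fh by (simp add: wcomp_diff_lincomb conj_space)
    then show "L (\<lambda>z. a * f z + b * h z) = a * L f + b * L h"
      unfolding L_def using fh u
      by (simp add: bergman_ip_lincomb bergman_ip_lincomb_right wcomp_diff_in_space conj_space algebra_simps)
  next
    fix f assume f: "f \<in> bergman_space \<alpha>"
    let ?N = "ip_norm (bergman_ip \<alpha>)"
    have "cmod (L f) \<le> cmod (bergman_ip \<alpha> (\<C> u) (\<D> (\<C> f))) + cmod (bergman_ip \<alpha> f (\<D> u))"
      unfolding L_def by (rule norm_triangle_ineq4)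
    also have "\<dots> \<le> ?N (\<C> u) * ?N (\<D> (\<C> f)) + ?N f * ?N (\<D> u)"
      using f u by (intro add_mono bergman_Cauchy_Schwarz wcomp_diff_in_space conj_space)
    also have "\<dots> \<le> ?N (\<C> u) * (M * ?N f) + ?N f * ?N (\<D> u)"
      using M[OF conj_space[OF f]] norm_conj[OF f]
      by (intro add_mono mult_left_mono ip_norm_bergman_nonneg) auto
    finally show "cmod (L f) \<le> (?N (\<C> u) * M + ?N (\<D> u)) * ?N f"
      by (simp add: algebra_simps)
  next
    fix w assume w: "w \<in> unit_disc"
    have "bergman_ip \<alpha> (\<C> u) (\<D> (\<C> (bergman_kernel \<alpha> 0 w))) = bergman_ip \<alpha> (adjoint_kernel \<alpha> n \<psi> \<phi> w) u"
      unfolding on_kernels[OF w] by (rule bergman_ip_conj_op[OF \<mu> \<eta> u adjoint_kernel_in_space[OF w]])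
    also have "\<dots> = cnj (\<D> u w)"
      unfolding cnj_bergman_ip[of \<alpha> u, symmetric] bergman_ip_adjoint_kernel(1)[OF w u] ..
    also have "\<dots> = bergman_ip \<alpha> (bergman_kernel \<alpha> 0 w) (\<D> u)"
      unfolding cnj_bergman_ip[of \<alpha> "\<D> u", symmetric] bergman_ip_adjoint_kernel(2)[OF w u] ..
    finally show "L (bergman_kernel \<alpha> 0 w) = 0"
      by (simp add: L_def)
  qed (rule g)
  then show ?thesis by (simp add: L_def)
qed

text \<open>
  Since the conjugation is an involution, complex symmetry means that \<open>\<D> \<circ> \<C>\<close> equals the
  composition of \<open>\<C>\<close> with the adjoint of \<open>\<D>\<close>.  It is enough to compare the two on kernels,
  where the adjoint is explicit.
\<close>

lemma complex_symmetric_iff_kernels: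
  "complex_symmetric_on (bergman_space \<alpha>) (bergman_ip \<alpha>) \<C> \<D>
    \<longleftrightarrow> (\<forall>w\<in>unit_disc. \<D> (\<C> (bergman_kernel \<alpha> 0 w)) = \<C> (adjoint_kernel \<alpha> n \<psi> \<phi> w))"
proof
  assume sym: "complex_symmetric_on (bergman_space \<alpha>) (bergman_ip \<alpha>) \<C> \<D>"
  show "\<forall>w\<in>unit_disc. \<D> (\<C> (bergman_kernel \<alpha> 0 w)) = \<C> (adjoint_kernel \<alpha> n \<psi> \<phi> w)"
  proof
    fix w :: complex assume w: "w \<in> unit_disc"
    have "\<C> (bergman_kernel \<alpha> 0 w) \<in> bergman_space \<alpha>"
      by (intro conj_op_in_bergman_space[OF \<eta>] bergman_kernel_in_space \<alpha> w)
    with sym show "\<D> (\<C> (bergman_kernel \<alpha> 0 w)) = \<C> (adjoint_kernel \<alpha> n \<psi> \<phi> w)"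
      unfolding complex_symmetric_on_def
      by (metis adjoint_on_kernel[OF w] conj_op_involutive[OF \<mu> \<eta>])
  qed
next
  assume on_kernels: "\<forall>w\<in>unit_disc. \<D> (\<C> (bergman_kernel \<alpha> 0 w)) = \<C> (adjoint_kernel \<alpha> n \<psi> \<phi> w)"
  show "complex_symmetric_on (bergman_space \<alpha>) (bergman_ip \<alpha>) \<C> \<D>"
    unfolding complex_symmetric_on_def
  proof (intro conjI ballI bounded conjugation_on_conj_op[OF \<mu> \<eta>])
    fix f assume f: "f \<in> bergman_space \<alpha>"
    note conj_space = conj_op_in_bergman_space[OF \<eta>, where \<mu> = \<mu>]
    have "adjoint_on (bergman_space \<alpha>) (bergman_ip \<alpha>) \<D> (\<C> f) = \<C> (\<D> f)"
    proof (rule adjoint_on_eqI)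
      fix u assume u: "u \<in> bergman_space \<alpha>"
      have "bergman_ip \<alpha> (\<C> u) (\<D> f) = bergman_ip \<alpha> (\<C> f) (\<D> u)"
        using wcomp_diff_conj_symmetric[OF _ u conj_space[OF f]] on_kernels by (simp add: conj_op_involutive[OF \<mu> \<eta>])
      then have "bergman_ip \<alpha> (\<D> u) (\<C> f) = bergman_ip \<alpha> (\<D> f) (\<C> u)"
        by (metis cnj_bergman_ip)
      also have "\<dots> = bergman_ip \<alpha> (\<C> (\<C> u)) (\<C> (\<D> f))"
        by (rule bergman_ip_conj_op[OF \<mu> \<eta> conj_space[OF u] wcomp_diff_in_space[OF f], symmetric])
      finally show "bergman_ip \<alpha> (\<D> u) (\<C> f) = bergman_ip \<alpha> u (\<C> (\<D> f))"
        by (simp add: conj_op_involutive[OF \<mu> \<eta>])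
    qed (intro conj_space wcomp_diff_in_space f)
    then show "\<D> f = \<C> (adjoint_on (bergman_space \<alpha>) (bergman_ip \<alpha>) \<D> (\<C> f))"
      by (simp add: conj_op_involutive[OF \<mu> \<eta>])
  qed
qed

text \<open>
  Evaluating at a point \<open>z\<close> both vectors that are compared on the kernel at \<open>w\<close>, and cancelling the
  common nonzero constant, turns complex symmetry into a symmetry in \<open>z\<close> and \<open>w\<close>.
\<close>

lemma complex_symmetric_iff_functional_equation:
  "complex_symmetric_on (bergman_space \<alpha>) (bergman_ip \<alpha>) \<C> \<D>
    \<longleftrightarrow> (\<forall>w\<in>unit_disc. \<forall>z\<in>unit_disc.
      \<psi> z * w ^ n * (1 - \<eta> * w * \<phi> z) powr (- of_real (real n + \<alpha> + 2))
      = \<psi> w * z ^ n * (1 - \<eta> * z * \<phi> w) powr (- of_real (real n + \<alpha> + 2)))"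
proof -
  have "\<D> (\<C> (bergman_kernel \<alpha> 0 w)) = \<C> (adjoint_kernel \<alpha> n \<psi> \<phi> w) \<longleftrightarrow>
    (\<forall>z\<in>unit_disc. \<psi> z * w ^ n * (1 - \<eta> * w * \<phi> z) powr (- of_real (real n + \<alpha> + 2))
      = \<psi> w * z ^ n * (1 - \<eta> * z * \<phi> w) powr (- of_real (real n + \<alpha> + 2)))" if w: "w \<in> unit_disc" for w
  proof -
    have "\<D> (\<C> (bergman_kernel \<alpha> 0 w)) z = \<C> (adjoint_kernel \<alpha> n \<psi> \<phi> w) z" if "z \<notin> unit_disc" for z
      using bergman_spaceD(2)[OF conj_op_in_bergman_space[OF \<eta> adjoint_kernel_in_space[OF w]] that] that
      by (simp add: wcomp_diff_def)
    then have "\<D> (\<C> (bergman_kernel \<alpha> 0 w)) = \<C> (adjoint_kernel \<alpha> n \<psi> \<phi> w) \<longleftrightarrow>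
        (\<forall>z\<in>unit_disc. \<D> (\<C> (bergman_kernel \<alpha> 0 w)) z = \<C> (adjoint_kernel \<alpha> n \<psi> \<phi> w) z)"
      unfolding fun_eq_iff by blast
    moreover have "pochhammer (\<alpha> + 2) n \<noteq> 0" "\<mu> \<noteq> 0" "\<eta> \<noteq> 0"
      using pochhammer_pos[of "\<alpha> + 2" n] \<alpha> \<mu> \<eta> by auto
    ultimately show ?thesis
      by (simp add: wcomp_diff_conj_kernel[OF w] conj_adjoint_kernel[OF w])
  qed
  then show ?thesis
    unfolding complex_symmetric_iff_kernels by blast
qed

end

section \<open>Solution of the functional equation\<close>

text \<open>
  Two arguments in \<open>(-pi / 2, pi / 2)\<close> add up to one in \<open>(-pi, pi)\<close>, so the principal logarithms add.
\<close>

lemma powr_mult_Re_pos: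
  fixes x y s :: complex
  assumes "0 < Re x" "0 < Re y"
  shows "(x * y) powr s = x powr s * y powr s"
proof -
  have nz: "x \<noteq> 0" "y \<noteq> 0" using assms by auto
  have "\<bar>Im (Ln x)\<bar> < pi / 2" "\<bar>Im (Ln y)\<bar> < pi / 2"
    by (rule Re_Ln_pos_lt_imp, rule assms)+
  then have "Ln (x * y) = Ln x + Ln y"
    by (intro Ln_times_simple nz) auto
  with nz show ?thesis
    by (simp add: powr_def algebra_simps exp_add)
qed

lemma has_field_derivative_powr_const:
  fixes f :: "complex \<Rightarrow> complex"
  assumes "(f has_field_derivative f') (at z)" "f z \<notin> \<real>\<^sub>\<le>\<^sub>0"
  shows "((\<lambda>z. f z powr s) has_field_derivative s * (f z powr s / f z) * f') (at z)"
proof -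
  have "f z \<noteq> 0" using assms(2) by auto
  with DERIV_chain2[OF has_field_derivative_powr[OF assms(2), of s] assms(1)]
  show ?thesis by (simp add: powr_diff)
qed

context
  fixes s :: real and n :: nat and \<eta> :: complex and \<phi> \<psi> :: "complex \<Rightarrow> complex"
  assumes \<eta>: "cmod \<eta> = 1"
    and \<phi>: "\<And>z. z \<in> unit_disc \<Longrightarrow> \<phi> z \<in> unit_disc"
begin

lemma one_minus_in_half_plane:
  assumes "z \<in> unit_disc" "w \<in> unit_disc"
  shows "0 < Re (1 - \<eta> * z * w)" "1 - \<eta> * z * w \<notin> \<real>\<^sub>\<le>\<^sub>0" "1 - \<eta> * z * w \<noteq> 0"
proof -
  have "cmod (\<eta> * z * w) < 1"
    using assms \<eta> by (intro norm_mult_less_one[of "\<eta> * z" w]) (auto simp: norm_mult)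
  from one_minus_notin_nonpos_Reals[OF this]
  show "0 < Re (1 - \<eta> * z * w)" "1 - \<eta> * z * w \<notin> \<real>\<^sub>\<le>\<^sub>0" "1 - \<eta> * z * w \<noteq> 0" by auto
qed

text \<open>
  Multiplying \<open>1 - \<eta> * w * \<phi> z\<close> by the denominator \<open>1 - \<eta> * b * z\<close> of \<open>\<phi>\<close> gives a polynomial that
  is symmetric in \<open>z\<close> and \<open>w\<close>, and the powers of the two factors multiply because both lie in the
  right half-plane.
\<close>

lemma functional_equation_if_explicit:
  assumes b: "b \<in> unit_disc"
    and \<psi>_eq: "\<And>z. z \<in> unit_disc \<Longrightarrow> \<psi> z = a * z ^ n / (1 - \<eta> * b * z) powr of_real s"
    and \<phi>_eq: "\<And>z. z \<in> unit_disc \<Longrightarrow> \<phi> z = b + c * z / (1 - \<eta> * b * z)"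
    and z: "z \<in> unit_disc" and w: "w \<in> unit_disc"
  shows "\<psi> z * w ^ n * (1 - \<eta> * w * \<phi> z) powr (- of_real s)
    = \<psi> w * z ^ n * (1 - \<eta> * z * \<phi> w) powr (- of_real s)"
proof -
  have split: "(1 - \<eta> * b * z) powr (- of_real s) * (1 - \<eta> * w * \<phi> z) powr (- of_real s)
      = ((1 - \<eta> * b * z) * (1 - \<eta> * b * w) - \<eta> * c * z * w) powr (- of_real s)"
    if z: "z \<in> unit_disc" and w: "w \<in> unit_disc" for z w
  proof -
    have "(1 - \<eta> * b * z) * (1 - \<eta> * w * \<phi> z) = (1 - \<eta> * b * z) * (1 - \<eta> * b * w) - \<eta> * c * z * w"
      unfolding \<phi>_eq[OF z] using one_minus_in_half_plane(3)[OF b z] by (simp add: field_simps)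
    with powr_mult_Re_pos[OF one_minus_in_half_plane(1)[OF b z] one_minus_in_half_plane(1)[OF w \<phi>[OF z]], of "- of_real s"]
    show ?thesis by simp
  qed
  have expand: "\<psi> z * w ^ n * (1 - \<eta> * w * \<phi> z) powr (- of_real s)
      = a * z ^ n * w ^ n * ((1 - \<eta> * b * z) * (1 - \<eta> * b * w) - \<eta> * c * z * w) powr (- of_real s)"
    if z: "z \<in> unit_disc" and w: "w \<in> unit_disc" for z w
    unfolding split[OF that, symmetric] \<psi>_eq[OF z] by (simp add: powr_minus field_simps)
  show ?thesis
    unfolding expand[OF z w] expand[OF w z] by (simp add: mult_ac)
qed

text \<open>
  Let \<open>b = \<phi> 0\<close>.  For fixed \<open>z\<close> the equation expresses \<open>\<psi> w / w ^ n\<close> through \<open>\<psi> z\<close> and \<open>\<phi>\<close>; as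
  \<open>w \<rightarrow> 0\<close> it tends to \<open>\<psi> z / z ^ n * (1 - \<eta> * b * z) powr s\<close>, which is therefore a constant \<open>a\<close>.
  This determines \<open>\<psi>\<close>, with \<open>a \<noteq> 0\<close>.  After cancelling the factors of \<open>\<psi>\<close>, an equation for \<open>\<phi>\<close>
  alone remains.  Taking roots in it would require following a branch; instead its derivative in
  \<open>z\<close> at \<open>0\<close> is a linear equation for \<open>\<phi> w\<close>, with solution \<open>b + c * w / (1 - \<eta> * b * w)\<close> for
  \<open>c = deriv \<phi> 0\<close>.
\<close>

lemma explicit_if_functional_equation:
  assumes s: "s > 0" and n: "n \<ge> 1" and hol: "\<phi> holomorphic_on unit_disc" and nz: "\<exists>z\<in>unit_disc. \<psi> z \<noteq> 0"
    and fe: "\<And>z w. z \<in> unit_disc \<Longrightarrow> w \<in> unit_disc \<Longrightarrow>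
      \<psi> z * w ^ n * (1 - \<eta> * w * \<phi> z) powr (- of_real s)
      = \<psi> w * z ^ n * (1 - \<eta> * z * \<phi> w) powr (- of_real s)"
  shows "\<exists>a c b. b \<in> unit_disc \<and> (\<forall>z\<in>unit_disc.
    \<psi> z = a * z ^ n / (1 - \<eta> * b * z) powr of_real s \<and> \<phi> z = b + c * z / (1 - \<eta> * b * z))"
proof -
  define b where "b = \<phi> 0"
  have b: "b \<in> unit_disc" using \<phi>[of 0] by (simp add: b_def)
  define G where "G z = \<psi> z / z ^ n" for z
  define q where "q z = (1 - \<eta> * b * z) powr of_real s" for z
  have q_nz: "q z \<noteq> 0" if "z \<in> unit_disc" for z
    using one_minus_in_half_plane(3)[OF b that] by (simp add: q_def)
  have cont: "isCont \<phi> 0"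
    using holomorphic_on_imp_continuous_on[OF hol] by (simp add: continuous_on_eq_continuous_at)
  have G_lim: "(G \<longlongrightarrow> G z * q z) (at 0)" if z: "z \<in> unit_disc" "z \<noteq> 0" for z
  proof -
    have notin: "1 - \<eta> * z * \<phi> 0 \<notin> \<real>\<^sub>\<le>\<^sub>0" by (intro one_minus_in_half_plane z \<phi>) simp
    have "((\<lambda>w. G z * (1 - \<eta> * w * \<phi> z) powr (- of_real s) * (1 - \<eta> * z * \<phi> w) powr of_real s)
        \<longlongrightarrow> G z * (1 - \<eta> * 0 * \<phi> z) powr (- of_real s) * (1 - \<eta> * z * \<phi> 0) powr of_real s) (at 0)"
      using notin by (intro tendsto_intros cont[unfolded isCont_def]) auto
    also have "G z * (1 - \<eta> * 0 * \<phi> z) powr (- of_real s) * (1 - \<eta> * z * \<phi> 0) powr of_real s = G z * q z"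
      by (simp add: q_def b_def mult_ac)
    finally show ?thesis
    proof (rule Lim_transform_within_open[of _ _ _ _ unit_disc])
      fix w :: complex assume w: "w \<in> unit_disc" "w \<noteq> 0"
      have "1 - \<eta> * z * \<phi> w \<noteq> 0" "1 - \<eta> * w * \<phi> z \<noteq> 0"
        by (intro one_minus_in_half_plane z \<phi> w)+
      then show "G z * (1 - \<eta> * w * \<phi> z) powr (- of_real s) * (1 - \<eta> * z * \<phi> w) powr of_real s = G w"
        using fe[OF z(1) w(1)] z w by (simp add: G_def powr_minus field_simps)
    qed auto
  qed
  \<comment> \<open>The expression does not depend on the point; \<open>1/2\<close> is an arbitrary nonzero one.\<close>
  define a where "a = G (1/2) * q (1/2)"
  have a: "G z * q z = a" if "z \<in> unit_disc" "z \<noteq> 0" for z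
    unfolding a_def using tendsto_unique[OF _ G_lim[OF that] G_lim[of "1/2"]] by simp
  have "\<psi> 0 = 0"
  proof -
    have "1 - \<eta> * (1/2) * \<phi> 0 \<noteq> 0" by (intro one_minus_in_half_plane \<phi>) auto
    then have "(1/2) ^ n * (1 - \<eta> * (1/2) * \<phi> 0) powr (- of_real s) \<noteq> 0"
      by (simp only: powr_eq_0_iff power_eq_0_iff mult_eq_0_iff) simp
    moreover have "(0 :: complex) ^ n = 0"
      using n by simp
    ultimately show ?thesis
      using fe[of 0 "1/2"] by (simp only: mult.assoc) simp
  qed
  have \<psi>_eq: "\<psi> z = a * z ^ n / q z" if "z \<in> unit_disc" for z
    using \<open>\<psi> 0 = 0\<close> n a[OF that] q_nz[OF that] by (cases "z = 0") (auto simp: G_def field_simps)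
  have "a \<noteq> 0"
    using nz \<psi>_eq by auto
  have \<phi>_eq: "\<phi> w = b + deriv \<phi> 0 * w / (1 - \<eta> * b * w)" if w: "w \<in> unit_disc" for w
  proof (cases "w = 0")
    case False
    let ?p = "- complex_of_real s"
    \<comment> \<open>Divided by \<open>a * z ^ n * w ^ n\<close>, the two sides of the equation become \<open>?l z\<close> and \<open>?r z\<close>; they also agree at \<open>z = 0\<close>.\<close>
    let ?l = "\<lambda>z. (1 - \<eta> * w * \<phi> z) powr ?p * (1 - \<eta> * b * z) powr ?p"
    let ?r = "\<lambda>z. (1 - \<eta> * b * w) powr ?p * (1 - \<eta> * z * \<phi> w) powr ?p"
    define d where "d = (1 - \<eta> * b * w) powr ?p"
    have d: "d \<noteq> 0" using one_minus_in_half_plane(3)[OF b w] by (simp add: d_def)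
    have wb: "1 - \<eta> * w * b = 1 - \<eta> * b * w" by (simp add: mult_ac)
    have eq: "?l z = ?r z" if z: "z \<in> unit_disc" for z
    proof (cases "z = 0")
      case True
      then show ?thesis by (simp add: b_def[symmetric] wb)
    next
      case zn: False
      have "a * z ^ n * w ^ n * ?l z = \<psi> z * w ^ n * (1 - \<eta> * w * \<phi> z) powr ?p"
        unfolding \<psi>_eq[OF z] q_def by (simp add: powr_minus field_simps)
      also have "\<dots> = \<psi> w * z ^ n * (1 - \<eta> * z * \<phi> w) powr ?p"
        by (rule fe[OF z w])
      also have "\<dots> = a * z ^ n * w ^ n * ?r z"
        unfolding \<psi>_eq[OF w] q_def by (simp add: powr_minus field_simps)
      finally show ?thesis
        using \<open>a \<noteq> 0\<close> zn False by simp
    qed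
    have \<phi>': "(\<phi> has_field_derivative deriv \<phi> 0) (at 0)"
      by (rule holomorphic_derivI[OF hol]) auto
    have "((\<lambda>z. 1 - \<eta> * w * \<phi> z) has_field_derivative - (\<eta> * w * deriv \<phi> 0)) (at 0)"
      by (auto intro!: derivative_eq_intros \<phi>')
    from has_field_derivative_powr_const[OF this one_minus_in_half_plane(2)[OF w \<phi>], of ?p]
    have 1: "((\<lambda>z. (1 - \<eta> * w * \<phi> z) powr ?p) has_field_derivative
        ?p * (d / (1 - \<eta> * b * w)) * - (\<eta> * w * deriv \<phi> 0)) (at 0)"
      by (simp add: d_def b_def[symmetric] wb)
    have "((\<lambda>z. 1 - \<eta> * b * z) has_field_derivative - (\<eta> * b)) (at 0)"
      by (auto intro!: derivative_eq_intros)
    from has_field_derivative_powr_const[OF this one_minus_in_half_plane(2)[OF b], of ?p]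
    have 2: "((\<lambda>z. (1 - \<eta> * b * z) powr ?p) has_field_derivative ?p * - (\<eta> * b)) (at 0)"
      by simp
    have "((\<lambda>z. 1 - \<eta> * z * \<phi> w) has_field_derivative - (\<eta> * \<phi> w)) (at 0)"
      by (auto intro!: derivative_eq_intros)
    from has_field_derivative_powr_const[OF this one_minus_in_half_plane(2)[OF _ \<phi>[OF w]], of ?p]
    have 3: "((\<lambda>z. (1 - \<eta> * z * \<phi> w) powr ?p) has_field_derivative ?p * - (\<eta> * \<phi> w)) (at 0)"
      by simp
    have "(?l has_field_derivative
        ?p * (d / (1 - \<eta> * b * w)) * - (\<eta> * w * deriv \<phi> 0) + ?p * - (\<eta> * b) * d) (at 0)"
      using DERIV_mult[OF 1 2] by (simp add: d_def b_def[symmetric] wb)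
    then have "(?r has_field_derivative
        ?p * (d / (1 - \<eta> * b * w)) * - (\<eta> * w * deriv \<phi> 0) + ?p * - (\<eta> * b) * d) (at 0)"
      by (rule has_field_derivative_transform_within_open[of _ _ _ unit_disc]) (use eq in auto)
    moreover have "(?r has_field_derivative d * (?p * - (\<eta> * \<phi> w))) (at 0)"
      using DERIV_cmult[OF 3] by (simp add: d_def)
    ultimately have "?p * (d / (1 - \<eta> * b * w)) * - (\<eta> * w * deriv \<phi> 0) + ?p * - (\<eta> * b) * d
        = d * (?p * - (\<eta> * \<phi> w))"
      by (rule DERIV_unique)
    then have "(of_real s * \<eta> * d) * (b + deriv \<phi> 0 * w / (1 - \<eta> * b * w)) = (of_real s * \<eta> * d) * \<phi> w"
      by (simp add: algebra_simps)
    moreover have "of_real s * \<eta> * d \<noteq> 0"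
      using s \<eta> d by auto
    ultimately show ?thesis by simp
  qed (simp add: b_def)
  show ?thesis
    using b \<psi>_eq \<phi>_eq unfolding q_def by blast
qed

end

theorem theorem2p1:
  fixes \<alpha> :: real and n :: nat and \<mu> \<eta> :: complex and \<phi> \<psi> :: "complex \<Rightarrow> complex"
  assumes "\<alpha> > -1" and "n \<ge> 1" and "cmod \<mu> = 1" and "cmod \<eta> = 1"
    and "\<phi> holomorphic_on unit_disc" and "\<forall>z\<in>unit_disc. \<phi> z \<in> unit_disc"
    and "\<psi> holomorphic_on unit_disc" and "\<exists>z\<in>unit_disc. \<psi> z \<noteq> 0"
    and "bounded_operator_on (bergman_space \<alpha>) (bergman_ip \<alpha>) (wcomp_diff n \<psi> \<phi>)"
  shows "complex_symmetric_on (bergman_space \<alpha>) (bergman_ip \<alpha>) (conj_op \<mu> \<eta>) (wcomp_diff n \<psi> \<phi>)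
    \<longleftrightarrow> (\<exists>a c b. b \<in> unit_disc \<and>
          (\<forall>z\<in>unit_disc.
             \<psi> z = a * z ^ n / (1 - \<eta> * b * z) powr of_real (real n + \<alpha> + 2) \<and>
             \<phi> z = b + c * z / (1 - \<eta> * b * z)))"
proof -
  define s where "s = real n + \<alpha> + 2"
  have s: "s > 0" using \<open>\<alpha> > -1\<close> by (simp add: s_def)
  have \<phi>: "\<phi> z \<in> unit_disc" if "z \<in> unit_disc" for z
    using that \<open>\<forall>z\<in>unit_disc. \<phi> z \<in> unit_disc\<close> by blast
  have "complex_symmetric_on (bergman_space \<alpha>) (bergman_ip \<alpha>) (conj_op \<mu> \<eta>) (wcomp_diff n \<psi> \<phi>)
    \<longleftrightarrow> (\<forall>w\<in>unit_disc. \<forall>z\<in>unit_disc. \<psi> z * w ^ n * (1 - \<eta> * w * \<phi> z) powr (- of_real s)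
      = \<psi> w * z ^ n * (1 - \<eta> * z * \<phi> w) powr (- of_real s))" (is "?sym \<longleftrightarrow> ?fe")
    unfolding s_def using assms \<phi> by (intro complex_symmetric_iff_functional_equation)
  also have "?fe \<longleftrightarrow> (\<exists>a c b. b \<in> unit_disc \<and> (\<forall>z\<in>unit_disc.
      \<psi> z = a * z ^ n / (1 - \<eta> * b * z) powr of_real s \<and> \<phi> z = b + c * z / (1 - \<eta> * b * z)))"
    (is "_ \<longleftrightarrow> ?explicit")
  proof
    assume ?fe
    then have fe: "\<psi> z * w ^ n * (1 - \<eta> * w * \<phi> z) powr (- of_real s)
        = \<psi> w * z ^ n * (1 - \<eta> * z * \<phi> w) powr (- of_real s)"
      if "z \<in> unit_disc" "w \<in> unit_disc" for z w
      using that by blast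
    show ?explicit
      by (rule explicit_if_functional_equation[OF \<open>cmod \<eta> = 1\<close> \<phi> s \<open>n \<ge> 1\<close>
          \<open>\<phi> holomorphic_on unit_disc\<close> \<open>\<exists>z\<in>unit_disc. \<psi> z \<noteq> 0\<close> fe])
  next
    assume ?explicit
    then obtain a c b where b: "b \<in> unit_disc"
      and eq: "\<And>z. z \<in> unit_disc \<Longrightarrow> \<psi> z = a * z ^ n / (1 - \<eta> * b * z) powr of_real s"
        "\<And>z. z \<in> unit_disc \<Longrightarrow> \<phi> z = b + c * z / (1 - \<eta> * b * z)"
      by blast
    show ?fe
      by (intro ballI functional_equation_if_explicit[OF \<open>cmod \<eta> = 1\<close> \<phi> b eq])
  qed
  finally show ?thesis unfolding s_def .
qed

end
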